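(* Let $T$ be a triangulation rooted at a cell $c_0$. For every subgroup $H$ of $\mathrm{Aut}(c_0,T)$ that contains at least one non-trivial automorphism, the following holds. (i) If $H$ contains a reflection but no rotation, then it is isomorphic to the 2-element group $\mathbb{Z}_2$. (ii) If $H$ contains $k\ge 1$ rotations but no reflection, then it is isomorphic to the cyclic group $\mathbb{Z}_{k+1}$, where $k+1$ is a divisor of $d(c_0)$. (iii) If $H$ contains both reflections and rotations, then it is isomorphic to a dihedral group $D_n$, where $n\ge 2$ is a divisor of $d(c_0)$.
   Context: All graphs are simple. A planar map is a graph embedded on a sphere; its faces are the connected components of the complement. Vertices, edges and faces are its cells, of dimension 0, 1, 2. Two cells of different dimension are incident if one is contained in the topological boundary of the other. A triangulation is a planar map in which every face boundary is a triangle; all triangulations are assumed non-trivial, i.e. to have more than four vertices. An automorphism of $T$ is a bijection of the set of cells preserving dimension and incidences (orientation reversal is allowed); for a cell $c$, $\mathrm{Aut}(c,T)$ is the group of automorphisms $\varphi$ with $\varphi(c)=c$. The root $c_0$ is an arbitrary fixed cell. For a cell $c$ of dimension $d$, the numbers of incident cells of dimensions $d+1$ and $d+2$ modulo 3 coincide; this number is the degree $d(c)$ (so $d(c)=2$ for an edge, $3$ for a face, the usual degree for a vertex). The $2d(c)$ cells incident with $c$ have a cyclic order, unique up to orientation, in which two cells are consecutive if and only if they are incident with each other. A non-identity $\varphi\in\mathrm{Aut}(c,T)$ is reflective at $c$ if it changes the orientation of this cyclic order, and rotative at $c$ otherwise. Elements of $\mathrm{Aut}(c_0,T)$ that are reflective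 (rotative) at $c_0$ are called reflections (rotations). $D_n$ denotes the dihedral group of order $2n$ (with $D_2\cong\mathbb{Z}_2\times\mathbb{Z}_2$). *)

theory Defs
  imports "HOL-Analysis.Analysis" "HOL-Algebra.Bij" "HOL-Algebra.Elementary_Groups"
begin

section \<open>Graphs embedded on the sphere\<close>

abbreviation unit_sphere :: "(real^3) set" where
  "unit_sphere \<equiv> sphere 0 1"

definition open_arc :: "real^3 \<Rightarrow> real^3 \<Rightarrow> (real^3) set \<Rightarrow> bool" where
  "open_arc a b e \<longleftrightarrow>
     (\<exists>g. arc g \<and> path_image g \<subseteq> unit_sphere \<and> pathstart g = a \<and> pathfinish g = b \<and>
          e = path_image g - {a, b})"

text \<open>An embedded graph is given by its vertices, which are points of the sphere, and its edges,
  which are point sets not containing their ends.\<close>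

record embedded_graph =
  verts :: "(real^3) set"
  edges :: "(real^3) set set"

text \<open>Simplicity: the library predicate \<^const>\<open>arc\<close> forces distinct ends, which excludes loops, and
  the last condition excludes parallel edges.\<close>

definition planar_map :: "embedded_graph \<Rightarrow> bool" where
  "planar_map T \<longleftrightarrow>
     finite (verts T) \<and> verts T \<subseteq> unit_sphere \<and>
     (\<forall>e\<in>edges T. \<exists>a\<in>verts T. \<exists>b\<in>verts T. open_arc a b e) \<and>
     (\<forall>e\<in>edges T. e \<inter> verts T = {}) \<and>
     pairwise disjnt (edges T) \<and>
     (\<forall>a b. \<forall>e\<in>edges T. \<forall>e'\<in>edges T. open_arc a b e \<longrightarrow> open_arc a b e' \<longrightarrow> e = e')"

definition faces :: "embedded_graph \<Rightarrow> (real^3) set set" where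
  "faces T = components (unit_sphere - (verts T \<union> \<Union>(edges T)))"

abbreviation sphere_boundary :: "(real^3) set \<Rightarrow> (real^3) set" where
  "sphere_boundary c \<equiv> top_of_set unit_sphere frontier_of c"

definition is_triangle :: "embedded_graph \<Rightarrow> (real^3) set \<Rightarrow> bool" where
  "is_triangle T B \<longleftrightarrow>
     (\<exists>u\<in>verts T. \<exists>v\<in>verts T. \<exists>w\<in>verts T.
      \<exists>e1\<in>edges T. \<exists>e2\<in>edges T. \<exists>e3\<in>edges T.
        distinct [u, v, w] \<and> open_arc u v e1 \<and> open_arc v w e2 \<and> open_arc w u e3 \<and>
        B = {u, v, w} \<union> e1 \<union> e2 \<union> e3)"

definition sphere_triangulation :: "embedded_graph \<Rightarrow> bool" where
  "sphere_triangulation T \<longleftrightarrow>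
     planar_map T \<and> card (verts T) > 4 \<and> (\<forall>f\<in>faces T. is_triangle T (sphere_boundary f))"


section \<open>Cells and incidence\<close>

text \<open>All cells are subsets of the sphere; the vertex \<open>v\<close> is represented by \<open>{v}\<close>.\<close>

definition vertex_cells :: "embedded_graph \<Rightarrow> (real^3) set set" where
  "vertex_cells T = (\<lambda>v. {v}) ` verts T"

definition cells :: "embedded_graph \<Rightarrow> (real^3) set set" where
  "cells T = vertex_cells T \<union> edges T \<union> faces T"

text \<open>In a planar map the three kinds of cells are disjoint, so this is unambiguous on cells.\<close>

definition cell_dim :: "embedded_graph \<Rightarrow> (real^3) set \<Rightarrow> nat" where
  "cell_dim T c = (if c \<in> vertex_cells T then 0 else if c \<in> edges T then 1 else 2)"

definition incident :: "embedded_graph \<Rightarrow> (real^3) set \<Rightarrow> (real^3) set \<Rightarrow> bool" where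
  "incident T x y \<longleftrightarrow>
     x \<in> cells T \<and> y \<in> cells T \<and> cell_dim T x \<noteq> cell_dim T y \<and>
     (x \<subseteq> sphere_boundary y \<or> y \<subseteq> sphere_boundary x)"

definition cell_degree :: "embedded_graph \<Rightarrow> (real^3) set \<Rightarrow> nat" where
  "cell_degree T c = card {x. incident T c x \<and> cell_dim T x = (cell_dim T c + 1) mod 3}"


section \<open>Automorphisms\<close>

definition cell_automorphisms :: "embedded_graph \<Rightarrow> ((real^3) set \<Rightarrow> (real^3) set) set" where
  "cell_automorphisms T =
     {\<phi> \<in> Bij (cells T).
        (\<forall>x\<in>cells T. cell_dim T (\<phi> x) = cell_dim T x) \<and>
        (\<forall>x\<in>cells T. \<forall>y\<in>cells T. incident T (\<phi> x) (\<phi> y) \<longleftrightarrow> incident T x y)}"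

definition Aut :: "(real^3) set \<Rightarrow> embedded_graph \<Rightarrow> ((real^3) set \<Rightarrow> (real^3) set) monoid" where
  "Aut c T = (BijGroup (cells T))\<lparr>carrier := {\<phi> \<in> cell_automorphisms T. \<phi> c = c}\<rparr>"

text \<open>A cyclic order together with an orientation is represented by a list, read cyclically: two
  lists represent the same oriented cyclic order iff they are rotations of each other, and
  reversing the list reverses the orientation.\<close>

definition cyclically_consecutive :: "nat \<Rightarrow> nat \<Rightarrow> nat \<Rightarrow> bool" where
  "cyclically_consecutive n i j \<longleftrightarrow> j = Suc i mod n \<or> i = Suc j mod n"

definition cyclic_order_at :: "embedded_graph \<Rightarrow> (real^3) set \<Rightarrow> (real^3) set list \<Rightarrow> bool" where
  "cyclic_order_at T c xs \<longleftrightarrow>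
     distinct xs \<and> set xs = {x. incident T c x} \<and>
     (\<forall>i<length xs. \<forall>j<length xs.
        cyclically_consecutive (length xs) i j \<longleftrightarrow> incident T (xs ! i) (xs ! j))"

definition reflective_at ::
    "embedded_graph \<Rightarrow> (real^3) set \<Rightarrow> ((real^3) set \<Rightarrow> (real^3) set) \<Rightarrow> bool" where
  "reflective_at T c \<phi> \<longleftrightarrow>
     \<phi> \<in> carrier (Aut c T) \<and> \<phi> \<noteq> \<one>\<^bsub>Aut c T\<^esub> \<and>
     (\<exists>xs k. cyclic_order_at T c xs \<and> map \<phi> xs = rotate k (rev xs))"

definition rotative_at ::
    "embedded_graph \<Rightarrow> (real^3) set \<Rightarrow> ((real^3) set \<Rightarrow> (real^3) set) \<Rightarrow> bool" where
  "rotative_at T c \<phi> \<longleftrightarrow>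
     \<phi> \<in> carrier (Aut c T) \<and> \<phi> \<noteq> \<one>\<^bsub>Aut c T\<^esub> \<and> \<not> reflective_at T c \<phi>"


section \<open>Dihedral groups\<close>

text \<open>The dihedral group of order \<open>2 * n\<close> for \<open>n > 0\<close>: the pair \<open>(a, s)\<close> stands for \<open>r\<^sup>a\<close> if
  \<open>s\<close> is false and for \<open>r\<^sup>a f\<close> if \<open>s\<close> is true, where \<open>f r = r\<^sup>-\<^sup>1 f\<close>.\<close>

definition dihedral_group :: "nat \<Rightarrow> (int \<times> bool) monoid" where
  "dihedral_group n =
     \<lparr>carrier = {0..<int n} \<times> UNIV,
      monoid.mult = (\<lambda>(a, s) (b, t). ((if s then a - b else a + b) mod int n, s \<noteq> t)),
      one = (0, False)\<rparr>"

lemma group_dihedral_group: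
  assumes "n > 0"
  shows "group (dihedral_group n)"
proof (rule groupI)
  fix x y z
  assume "x \<in> carrier (dihedral_group n)" "y \<in> carrier (dihedral_group n)"
    "z \<in> carrier (dihedral_group n)"
  then show "x \<otimes>\<^bsub>dihedral_group n\<^esub> y \<otimes>\<^bsub>dihedral_group n\<^esub> z
      = x \<otimes>\<^bsub>dihedral_group n\<^esub> (y \<otimes>\<^bsub>dihedral_group n\<^esub> z)"
    by (auto simp: dihedral_group_def mod_simps algebra_simps split: prod.splits)
next
  fix x
  assume x: "x \<in> carrier (dihedral_group n)"
  then obtain a s where as: "x = (a, s)" "0 \<le> a" "a < int n"
    by (auto simp: dihedral_group_def)
  let ?y = "(if s then a else (- a) mod int n, s)"
  have "?y \<in> carrier (dihedral_group n)" "?y \<otimes>\<^bsub>dihedral_group n\<^esub> x = \<one>\<^bsub>dihedral_group n\<^esub>"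
    using assms as by (auto simp: dihedral_group_def mod_simps)
  then show "\<exists>y\<in>carrier (dihedral_group n). y \<otimes>\<^bsub>dihedral_group n\<^esub> x = \<one>\<^bsub>dihedral_group n\<^esub>"
    by blast
qed (use assms in \<open>auto simp: dihedral_group_def\<close>)

lemma order_dihedral_group: "order (dihedral_group n) = 2 * n"
  by (simp add: order_def dihedral_group_def card_cartesian_product)

end

theory Submission
  imports Defs
begin

text \<open>The proof makes the group \<open>Aut c\<^sub>0 T\<close> act faithfully on a cycle. The cells incident with
  \<open>c\<^sub>0\<close> form its link; joining incident ones, they turn out to be a cycle of length \<open>2 d\<close>, where \<open>d\<close> is
  the degree of \<open>c\<^sub>0\<close>. An automorphism fixing \<open>c\<^sub>0\<close> induces a symmetry of this cycle. As dimensions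
  alternate around the cycle and are preserved, only half of its symmetries can occur, and these form
  the dihedral group of order \<open>2 d\<close>. Automorphisms that are reflective at \<open>c\<^sub>0\<close> become the reflections
  of this group (\<open>dihedral_representation\<close>). The theorem then is the classification of the
  subgroups of a dihedral group (\<open>dihedral_group_submonoid\<close>): the rotations in a subgroup, with the
  identity, form a cyclic group whose order \<open>n\<close> divides \<open>d\<close>, and a subgroup with a reflection is
  dihedral of order \<open>2 n\<close>, which for \<open>n = 1\<close> is the group with two elements.

  Two combinatorial properties of \<open>T\<close> carry the argument. The diamond property (\<open>card_between\<close>) says
  that for two incident cells there are exactly two cells incident with both; it makes every link
  2-regular. Connectedness holds locally, of each link (\<open>link_connected\<close>), and globally, of the faces
  under adjacency across edges (\<open>faces_strongly_connected\<close>). A finite connected 2-regular graph is a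
  cycle (\<open>two_regular_connected_cycle\<close>), and an automorphism that fixes a link pointwise is the identity
  (\<open>automorphism_fixing_link_trivial\<close>), because by the diamond property fixed cells spread to all
  neighbours.

  Both properties come from the topology of the sphere. By the Jordan curve theorem the far side of a
  face is connected and has the whole boundary triangle in its closure, which gives every edge at
  least two faces; Janiszewski's theorem excludes a third one (\<open>edge_not_three_faces\<close>).
  Connectedness, in both forms, holds because a connected set that avoids the vertices is covered by the
  closures of the faces, and two closures meet in it only along common edges
  (\<open>face_classes_exhaust\<close>). It is applied to a punctured disc around a vertex and to the sphere without
  the vertices.\<close>

section \<open>The sphere near a point\<close>

text \<open>Through these charts the Jordan curve theorem and the theorem of Janiszewski, which are
  theorems about the complex plane, apply on the sphere. The pole \<open>z\<close> is chosen anew at each use,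
  at a point that the argument has to avoid.\<close>

lemma punctured_sphere_chart:
  assumes "z \<in> unit_sphere"
  obtains h k where "homeomorphism (unit_sphere - {z}) (UNIV::complex set) h k"
proof -
  obtain P :: "(real^3) set" where P: "affine P" "aff_dim P = 2"
    using choose_affine_subset[of "UNIV::(real^3) set" 2] by (auto simp: aff_dim_UNIV)
  have "(unit_sphere - {z}) homeomorphic P"
    using assms P by (intro homeomorphic_punctured_sphere_affine) auto
  moreover have "P homeomorphic (UNIV::complex set)"
    using P by (intro homeomorphic_affine_sets) (auto simp: aff_dim_UNIV)
  ultimately have "(unit_sphere - {z}) homeomorphic (UNIV::complex set)"
    using homeomorphic_trans by blast
  then show ?thesis using that by (auto simp: homeomorphic_def)
qed

lemma chart_inverse_open:
  assumes hk: "homeomorphism (unit_sphere - {z}) (UNIV::complex set) h k" and "open U"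
  shows "openin (top_of_set unit_sphere) (k ` U)"
proof -
  have "openin (top_of_set (unit_sphere - {z})) (k ` U)"
    using homeomorphism_imp_open_map[OF homeomorphism_symD[OF hk], of U] assms(2) by simp
  moreover have "openin (top_of_set unit_sphere) (unit_sphere - {z})"
    by (metis openin_delete openin_subtopology_self)
  ultimately show ?thesis using openin_trans by blast
qed

text \<open>A small disc stays connected when any one point is taken out. With \<open>q = p\<close> this yields a
  connected punctured neighbourhood of a vertex; with a variable \<open>q\<close> it tells a disc from a piece
  of an arc.\<close>

lemma small_disc_minus_point_connected:
  assumes W: "openin (top_of_set unit_sphere) W" and p: "p \<in> W"
  obtains N where "openin (top_of_set unit_sphere) N" "p \<in> N" "N \<subseteq> W"
    "\<And>q. connected (N - {q})" "infinite N"
proof -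
  have pS: "p \<in> unit_sphere" using W p openin_imp_subset by blast
  then have "norm p = 1" by simp
  then have "- p \<in> unit_sphere" "p \<noteq> 0" by auto
  then have "- p \<noteq> p" by (metis neg_equal_0_iff_equal scaleR_2 scaleR_eq_0_iff add_eq_0_iff zero_neq_numeral)
  then obtain z where z: "z \<in> unit_sphere" "z \<noteq> p" using \<open>- p \<in> unit_sphere\<close> by blast
  obtain h k where hk: "homeomorphism (unit_sphere - {z}) (UNIV::complex set) h k"
    using punctured_sphere_chart z by blast
  have kh: "\<And>x. x \<in> unit_sphere - {z} \<Longrightarrow> k (h x) = x" and hkx: "\<And>y. h (k y) = y"
    and kim: "range k = unit_sphere - {z}" and ck: "continuous_on UNIV k"
    using hk unfolding homeomorphism_def by auto
  have "openin (top_of_set unit_sphere) (W - {z})" using W by (simp add: openin_delete)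
  then have "openin (top_of_set (unit_sphere - {z})) (W - {z})"
    by (metis Diff_mono openin_imp_subset openin_subset_trans W Diff_subset order_refl)
  then have "open (h ` (W - {z}))"
    using homeomorphism_imp_open_map[OF hk] by fastforce
  then obtain r where r: "r > 0" "ball (h p) r \<subseteq> h ` (W - {z})"
    using p z by (metis DiffI image_eqI open_contains_ball singletonD)
  let ?N = "k ` ball (h p) r"
  have inj: "inj k" by (metis hkx injI)
  show ?thesis
  proof
    show "openin (top_of_set unit_sphere) ?N" using chart_inverse_open[OF hk] by simp
    show "p \<in> ?N" using kh[of p] pS z r(1) by (metis DiffI centre_in_ball image_eqI singletonD)
    show "?N \<subseteq> W"
    proof
      fix x assume "x \<in> ?N"
      then obtain w where "w \<in> W - {z}" "x = k (h w)" using r(2) by blast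
      then show "x \<in> W" using kh[of w] openin_imp_subset[OF W] by auto
    qed
    show "infinite ?N"
    proof
      assume "finite ?N"
      then have "finite (ball (h p) r)" using inj by (meson finite_imageD inj_on_subset subset_UNIV)
      then show False using uncountable_ball[of r "h p"] r(1) by (auto simp: countable_finite)
    qed
    fix q
    have "?N - {q} = k ` (ball (h p) r - {h q})" if "q \<in> ?N"
      using that hkx by (auto, metis)
    moreover have "connected (ball (h p) r - {h q})"
      using connected_open_delete[of "ball (h p) r" "h q"] by simp
    moreover have "?N - {q} = ?N" if "q \<notin> ?N" using that by blast
    moreover have "connected (k ` A)" if "connected A" for A
      using that ck by (meson connected_continuous_image continuous_on_subset subset_UNIV)
    ultimately show "connected (?N - {q})" by (metis connected_ball)
  qed
qed

text \<open>An arc contains no disc: the parameters of a disc contained in the arc would form a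
  connected set of reals with at least two points. Removing a point between them cuts this set,
  but does not cut the disc.\<close>

lemma arc_image_empty_interior:
  assumes "arc g" and "openin (top_of_set unit_sphere) W" and "W \<subseteq> path_image g"
  shows "W = {}"
proof (rule ccontr)
  assume "W \<noteq> {}"
  then obtain p where "p \<in> W" by blast
  then obtain N where N: "N \<subseteq> W" "\<And>q. connected (N - {q})" "infinite N"
    using small_disc_minus_point_connected[OF assms(2)] by metis
  obtain g' where g': "homeomorphism {0..1} (path_image g) g g'"
    using assms(1) homeomorphism_arc by blast
  then have cg': "continuous_on (path_image g) g'" and gg': "\<And>x. x \<in> path_image g \<Longrightarrow> g (g' x) = x"
    unfolding homeomorphism_def by auto
  have Np: "N \<subseteq> path_image g" using N(1) assms(3) by blast
  have con: "connected (g' ` (N - {q}))" for q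
    using N(2) Np cg' by (meson Diff_subset connected_continuous_image continuous_on_subset subset_trans)
  have inj: "inj_on g' N" using Np gg' by (metis inj_on_def subsetD)
  obtain a b where ab: "a \<in> g' ` N" "b \<in> g' ` N" "a < b"
  proof -
    have "infinite (g' ` N)" using N(3) inj finite_imageD by blast
    then obtain a where a: "a \<in> g' ` N" by (metis ex_in_conv finite.emptyI)
    have "infinite (g' ` N - {a})" using \<open>infinite (g' ` N)\<close> by simp
    then obtain b where "b \<in> g' ` N - {a}" by (metis ex_in_conv finite.emptyI)
    then show ?thesis using that a by (metis DiffE insertI1 linorder_neqE)
  qed
  have "connected N"
  proof -
    have "0 \<notin> N" using N(1) openin_imp_subset[OF assms(2)] by auto
    then show ?thesis using N(2)[of 0] by simp
  qed
  then have "connected (g' ` N)"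
    using Np cg' by (meson connected_continuous_image continuous_on_subset)
  then have "(a + b) / 2 \<in> g' ` N"
    using connectedD_interval[OF _ ab(1,2), of "(a + b) / 2"] ab(3) by simp
  then obtain q where q: "q \<in> N" "g' q = (a + b) / 2" by auto
  have "a \<in> g' ` (N - {q})" "b \<in> g' ` (N - {q})" using ab q by auto
  then have "(a + b) / 2 \<in> g' ` (N - {q})"
    using connectedD_interval[OF con[of q], of a b "(a + b) / 2"] ab(3) by simp
  then show False using q inj by (auto dest: inj_onD)
qed

section \<open>Open arcs and the two sides of a closed curve\<close>

lemma openin_restrict:
  assumes "openin (top_of_set S) A" "X \<subseteq> S"
  shows "openin (top_of_set X) (X \<inter> A)"
proof -
  obtain U where "open U" "A = S \<inter> U" using assms(1) unfolding openin_open by blast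
  then have "X \<inter> A = X \<inter> U" using assms(2) by blast
  then show ?thesis using \<open>open U\<close> by (simp add: openin_open_Int)
qed

text \<open>Connectedness in the form in which it is used below: both open sets may reach outside of
  \<open>X\<close>.\<close>

lemma connected_openin_split:
  assumes "connected X" "openin (top_of_set S) A" "openin (top_of_set S) B" "X \<subseteq> S"
    "X \<subseteq> A \<union> B" "X \<inter> A \<inter> B = {}"
  shows "X \<inter> A = {} \<or> X \<inter> B = {}"
proof -
  have "openin (top_of_set X) (X \<inter> A)" "openin (top_of_set X) (X \<inter> B)"
    using openin_restrict assms by blast+
  moreover have "X \<subseteq> (X \<inter> A) \<union> (X \<inter> B)" "(X \<inter> A) \<inter> (X \<inter> B) = {}" using assms(5,6) by auto
  ultimately show ?thesis using assms(1) unfolding connected_openin by metis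
qed

lemma open_arc_properties:
  assumes "open_arc a b e"
  shows "a \<noteq> b" "closure e = e \<union> {a, b}" "a \<notin> e" "b \<notin> e" "e \<noteq> {}" "connected e"
    "closure e \<subseteq> unit_sphere" "\<exists>g. arc g \<and> path_image g = closure e \<and> pathstart g = a \<and> pathfinish g = b"
proof -
  obtain g where g: "arc g" "path_image g \<subseteq> unit_sphere" "pathstart g = a" "pathfinish g = b"
    and e: "e = path_image g - {a, b}"
    using assms unfolding open_arc_def by blast
  have inj: "inj_on g {0..1}" and cg: "continuous_on {0..1} g"
    using g(1) by (auto simp: arc_def path_def)
  show "a \<noteq> b" using g arc_distinct_ends by blast
  have ab: "g 0 = a" "g 1 = b" using g by (auto simp: pathstart_def pathfinish_def)
  have "{0..1::real} = {0<..<1} \<union> {0, 1}" by auto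
  then have eg: "e = g ` {0<..<1}"
    unfolding e path_image_def using ab inj by (auto simp: inj_on_def)
  show "a \<notin> e" "b \<notin> e" using e by auto
  show "e \<noteq> {}" unfolding eg by simp
  show "connected e"
    unfolding eg using cg by (intro connected_continuous_image) (auto intro: continuous_on_subset)
  have "g ` closure {0<..<1} \<subseteq> closure e"
    unfolding eg using cg by (intro image_closure_subset) (auto simp: closure_subset)
  then have "path_image g \<subseteq> closure e" by (simp add: path_image_def)
  moreover have "closure e \<subseteq> path_image g"
    using e g(1) by (intro closure_minimal) (auto simp: closed_arc_image)
  ultimately have cl: "closure e = path_image g" by simp
  then show "closure e = e \<union> {a, b}"
    using e g pathstart_in_path_image pathfinish_in_path_image by fastforce
  show "closure e \<subseteq> unit_sphere" using cl g(2) by simp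
  show "\<exists>g. arc g \<and> path_image g = closure e \<and> pathstart g = a \<and> pathfinish g = b" using g cl by metis
qed

text \<open>The ends of an open arc can be read off from the point set, as its closure minus itself.\<close>

lemma open_arc_ends:
  assumes "open_arc a b e" "open_arc a' b' e"
  shows "{a, b} = {a', b'}"
proof -
  have "closure e - e = {a, b}" using open_arc_properties(2-4)[OF assms(1)] by auto
  moreover have "closure e - e = {a', b'}" using open_arc_properties(2-4)[OF assms(2)] by auto
  ultimately show ?thesis by simp
qed

lemma empty_interior_finite_Union:
  assumes "finite F"
    and "\<And>A. A \<in> F \<Longrightarrow> closed A"
    and "\<And>A W. A \<in> F \<Longrightarrow> openin (top_of_set unit_sphere) W \<Longrightarrow> W \<subseteq> A \<Longrightarrow> W = {}"
    and "openin (top_of_set unit_sphere) W" "W \<subseteq> \<Union>F"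
  shows "W = {}"
  using assms
proof (induction F arbitrary: W rule: finite_induct)
  case (insert A F)
  have "closed (\<Union>F)" using insert by (intro closed_Union) auto
  then have "openin (top_of_set unit_sphere) (W - \<Union>F)"
    using insert.prems(3) by (metis Diff_eq openin_Int_open open_Compl)
  moreover have "W - \<Union>F \<subseteq> A" using insert.prems(4) by auto
  ultimately have "W \<subseteq> \<Union>F" using insert.prems(2) by blast
  then show ?case using insert.IH insert.prems by (metis insertI2)
qed auto

lemma openin_sphere_infinite:
  assumes "openin (top_of_set unit_sphere) W" "W \<noteq> {}"
  shows "infinite W"
proof -
  obtain p where "p \<in> W" using assms(2) by blast
  then obtain N where "N \<subseteq> W" "infinite N"
    by (rule small_disc_minus_point_connected[OF assms(1)])
  then show ?thesis using finite_subset by blast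
qed

lemma sphere_boundary_open:
  assumes "openin (top_of_set unit_sphere) f"
  shows "sphere_boundary f = closure f - f" and "closure f \<subseteq> unit_sphere"
proof -
  have f: "f \<subseteq> unit_sphere" using assms openin_imp_subset by blast
  show cl: "closure f \<subseteq> unit_sphere" using f by (simp add: closure_minimal)
  show "sphere_boundary f = closure f - f"
    using cl f interior_of_openin[OF assms] by (auto simp: frontier_of_def closure_of_subtopology inf_absorb2)
qed

text \<open>A domain \<open>f\<close> whose boundary lies on a closed curve is open and closed in the complement of
  the curve, so it is one of the two components. When the pole of the chart lies in \<open>f\<close>, the other
  component is the inside of the image curve in the plane, and the Jordan curve theorem describes
  it.\<close>

lemma jordan_disc_complement:
  assumes p: "simple_path p" "pathfinish p = pathstart p" "path_image p \<subseteq> unit_sphere"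
    and f: "openin (top_of_set unit_sphere) f" "connected f" "f \<noteq> {}"
      "f \<inter> path_image p = {}" "closure f \<subseteq> f \<union> path_image p"
  defines "D \<equiv> unit_sphere - path_image p - f"
  shows "openin (top_of_set unit_sphere) D" "connected D" "path_image p \<subseteq> closure D"
proof -
  obtain z where z: "z \<in> f" using f(3) by blast
  have zS: "z \<in> unit_sphere" using z f(1) openin_imp_subset by blast
  obtain h k where hk: "homeomorphism (unit_sphere - {z}) (UNIV::complex set) h k"
    using punctured_sphere_chart zS by blast
  have kh: "\<And>x. x \<in> unit_sphere - {z} \<Longrightarrow> k (h x) = x" and hkx: "\<And>y. h (k y) = y"
    and kim: "range k = unit_sphere - {z}" and ck: "continuous_on UNIV k"
    and ch: "continuous_on (unit_sphere - {z}) h"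
    using hk unfolding homeomorphism_def by auto
  let ?B = "path_image p"
  have BS: "?B \<subseteq> unit_sphere - {z}" using p(3) z f(4) by blast
  define q where "q = h \<circ> p"
  have "inj_on h (unit_sphere - {z})" using kh by (metis inj_onI)
  then have q: "simple_path q" "pathfinish q = pathstart q" "path_image q = h ` ?B"
    unfolding q_def using p BS ch
    by (auto simp: path_image_compose pathstart_compose pathfinish_compose intro!: simple_path_continuous_image intro: continuous_on_subset inj_on_subset)
  let ?I = "inside (path_image q)" and ?U = "outside (path_image q)"
  have I: "?I \<noteq> {}" "open ?I" "connected ?I" "bounded ?I" "?I \<inter> ?U = {}" "?I \<union> ?U = - path_image q"
    "frontier ?I = path_image q" "connected ?U" "open ?U"
    using Jordan_inside_outside[OF q(1,2)] by auto
  have clI: "closure ?I = ?I \<union> path_image q"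
    using I(2,7) by (metis closure_Un_frontier)
  have injk: "inj k" by (metis hkx injI)
  have kB: "k ` path_image q = ?B" unfolding q(3) image_image using kh BS by force
  have part: "unit_sphere - ?B = k ` ?I \<union> (k ` ?U \<union> {z})" "k ` ?I \<inter> (k ` ?U \<union> {z}) = {}"
  proof -
    have "k ` ?I \<union> k ` ?U = range k - k ` path_image q"
      using I(6) by (metis image_Un image_set_diff[OF injk] Compl_eq_Diff_UNIV)
    then show "unit_sphere - ?B = k ` ?I \<union> (k ` ?U \<union> {z})" using kim kB zS BS by auto
    have "k ` ?I \<inter> k ` ?U = {}" using I(5) by (metis image_Int[OF injk] image_empty)
    moreover have "z \<notin> k ` ?I" using kim by blast
    ultimately show "k ` ?I \<inter> (k ` ?U \<union> {z}) = {}" by blast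
  qed
  have oI: "openin (top_of_set unit_sphere) (k ` ?I)" and oU: "openin (top_of_set unit_sphere) (k ` ?U)"
    using chart_inverse_open[OF hk] I by auto
  have "compact (closure ?I)" using I(4) by simp
  then have cpt: "compact (k ` closure ?I)"
    using ck by (meson compact_continuous_image continuous_on_subset subset_UNIV)
  \<comment> \<open>Openness at the pole: the closed inside is compact and stays away from \<open>z\<close>.\<close>
  have "k ` ?U \<union> {z} = unit_sphere - k ` closure ?I"
    using part clI kB p(3) BS by (auto simp: image_Un)
  then have oU': "openin (top_of_set unit_sphere) (k ` ?U \<union> {z})"
    using cpt by (metis Diff_eq openin_open_Int open_Compl compact_imp_closed)
  have fS: "f \<subseteq> unit_sphere - ?B" using f(1,4) openin_imp_subset by blast
  have fU: "f \<subseteq> k ` ?U \<union> {z}"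
  proof -
    have "f \<inter> k ` ?I = {} \<or> f \<inter> (k ` ?U \<union> {z}) = {}"
      using fS part by (intro connected_openin_split[OF f(2) oI oU']) auto
    moreover have "z \<in> f \<inter> (k ` ?U \<union> {z})" using z by simp
    ultimately have "f \<inter> k ` ?I = {}" by blast
    then show ?thesis using fS part(1) by blast
  qed
  have "k ` ?U \<subseteq> f"
  proof -
    have con: "connected (k ` ?U)" using I ck by (meson connected_continuous_image continuous_on_subset subset_UNIV)
    have UB: "k ` ?U \<subseteq> unit_sphere - ?B" using part by blast
    obtain y where "y \<in> f" "y \<noteq> z"
      using openin_sphere_infinite[OF f(1,3)] by (metis finite.simps insert_iff subsetI finite_subset ex_in_conv)
    then have ne: "k ` ?U \<inter> f \<noteq> {}" using fU by blast
    have o2: "openin (top_of_set unit_sphere) (unit_sphere - closure f)"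
      by (metis Diff_eq openin_open_Int open_Compl closed_closure)
    have "k ` ?U \<inter> f = {} \<or> k ` ?U \<inter> (unit_sphere - closure f) = {}"
      using f(5) UB closure_subset[of f] by (intro connected_openin_split[OF con f(1) o2]) auto
    then show ?thesis using ne UB f(5) by blast
  qed
  then have "f = k ` ?U \<union> {z}" using fU z by blast
  then have D: "D = k ` ?I" unfolding D_def using part by blast
  show "openin (top_of_set unit_sphere) D" using D oI by simp
  show "connected D" unfolding D using I ck by (meson connected_continuous_image continuous_on_subset subset_UNIV)
  have "k ` closure ?I \<subseteq> closure D"
    unfolding D using ck by (intro image_closure_subset) (auto simp: closure_subset intro: continuous_on_subset)
  then show "?B \<subseteq> closure D" using clI kB by blast
qed

section \<open>The skeleton and the faces of a triangulation\<close>

definition skeleton :: "embedded_graph \<Rightarrow> (real^3) set" where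
  "skeleton T = verts T \<union> \<Union>(edges T)"

lemma planar_mapD:
  assumes "planar_map T"
  shows "finite (verts T)" "verts T \<subseteq> unit_sphere"
    "\<forall>e\<in>edges T. \<exists>a\<in>verts T. \<exists>b\<in>verts T. open_arc a b e"
    "\<forall>e\<in>edges T. e \<inter> verts T = {}"
    "pairwise disjnt (edges T)"
    "\<forall>a b. \<forall>e\<in>edges T. \<forall>e'\<in>edges T. open_arc a b e \<longrightarrow> open_arc a b e' \<longrightarrow> e = e'"
  by (insert assms, unfold planar_map_def, (elim conjE, assumption)+)

text \<open>The description of a triangle can be rotated so that a given side comes first.\<close>

lemma triangle_from_edge:
  assumes "planar_map T" "is_triangle T B" "e \<in> edges T" "e \<inter> B \<noteq> {}"
  obtains u v w e2 e3 where "u \<in> verts T" "v \<in> verts T" "w \<in> verts T" "e2 \<in> edges T" "e3 \<in> edges T"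
    "distinct [u, v, w]" "open_arc u v e" "open_arc v w e2" "open_arc w u e3"
    "B = {u, v, w} \<union> e \<union> e2 \<union> e3"
proof -
  obtain u v w e1 e2 e3 where t: "u \<in> verts T" "v \<in> verts T" "w \<in> verts T"
    "e1 \<in> edges T" "e2 \<in> edges T" "e3 \<in> edges T"
    "distinct [u, v, w]" "open_arc u v e1" "open_arc v w e2" "open_arc w u e3"
    "B = {u, v, w} \<union> e1 \<union> e2 \<union> e3"
    using assms(2) unfolding is_triangle_def by blast
  have "e \<inter> verts T = {}" "\<And>e'. e' \<in> edges T \<Longrightarrow> e \<noteq> e' \<Longrightarrow> e \<inter> e' = {}"
    using planar_mapD(4,5)[OF assms(1)] assms(3) unfolding pairwise_def disjnt_def by blast+
  then have "e = e1 \<or> e = e2 \<or> e = e3" using assms(4) t by blast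
  then show ?thesis
  proof (elim disjE)
    assume "e = e1"
    then show ?thesis using that[of u v w e2 e3] t by simp
  next
    assume "e = e2"
    then show ?thesis using that[of v w u e3 e1] t by auto
  next
    assume "e = e3"
    then show ?thesis using that[of w u v e1 e2] t by auto
  qed
qed

lemma triangle_simple_closed_path:
  assumes "planar_map T" "is_triangle T B"
  obtains p where "simple_path p" "pathfinish p = pathstart p" "path_image p = B"
proof -
  obtain u v w e1 e2 e3 where t: "u \<in> verts T" "v \<in> verts T" "w \<in> verts T"
    "e1 \<in> edges T" "e2 \<in> edges T" "e3 \<in> edges T"
    "distinct [u, v, w]" "open_arc u v e1" "open_arc v w e2" "open_arc w u e3"
    "B = {u, v, w} \<union> e1 \<union> e2 \<union> e3"
    using assms(2) unfolding is_triangle_def by blast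
  have ev: "\<And>e. e \<in> edges T \<Longrightarrow> e \<inter> verts T = {}" and
    dj: "\<And>e e'. e \<in> edges T \<Longrightarrow> e' \<in> edges T \<Longrightarrow> e \<noteq> e' \<Longrightarrow> e \<inter> e' = {}"
    using planar_mapD(4,5)[OF assms(1)] unfolding pairwise_def disjnt_def by blast+
  have "e1 \<noteq> e2" using open_arc_ends[of u v e1 v w] t by (auto simp: doubleton_eq_iff)
  moreover have "e1 \<noteq> e3" using open_arc_ends[of u v e1 w u] t by (auto simp: doubleton_eq_iff)
  moreover have "e2 \<noteq> e3" using open_arc_ends[of v w e2 w u] t by (auto simp: doubleton_eq_iff)
  ultimately have d3: "e1 \<inter> e2 = {}" "e1 \<inter> e3 = {}" "e2 \<inter> e3 = {}" using dj t by auto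
  have v3: "e1 \<inter> {u,v,w} = {}" "e2 \<inter> {u,v,w} = {}" "e3 \<inter> {u,v,w} = {}" using ev[OF t(4)] ev[OF t(5)] ev[OF t(6)] t(1-3) by auto
  obtain g1 where g1: "arc g1" "path_image g1 = e1 \<union> {u, v}" "pathstart g1 = u" "pathfinish g1 = v"
    using open_arc_properties(8)[OF t(8)] open_arc_properties(2)[OF t(8)] by auto
  obtain g2 where g2: "arc g2" "path_image g2 = e2 \<union> {v, w}" "pathstart g2 = v" "pathfinish g2 = w"
    using open_arc_properties(8)[OF t(9)] open_arc_properties(2)[OF t(9)] by auto
  obtain g3 where g3: "arc g3" "path_image g3 = e3 \<union> {w, u}" "pathstart g3 = w" "pathfinish g3 = u"
    using open_arc_properties(8)[OF t(10)] open_arc_properties(2)[OF t(10)] by auto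
  have a12: "arc (g1 +++ g2)"
    using g1 g2 d3 v3 t(7) by (intro arc_join) auto
  have pi12: "path_image (g1 +++ g2) = e1 \<union> {u, v} \<union> e2 \<union> {v, w}"
    using g1 g2 by (subst path_image_join) auto
  have "simple_path ((g1 +++ g2) +++ g3)"
  proof (rule simple_path_join_loop[OF a12 g3(1)])
    show "path_image (g1 +++ g2) \<inter> path_image g3 \<subseteq> {pathstart (g1 +++ g2), pathstart g3}"
      unfolding pi12 g3(2) using d3 v3 t(7) g1 g3 by auto
  qed (use g1 g2 g3 in auto)
  moreover have "path_image ((g1 +++ g2) +++ g3) = B"
    using pi12 g1 g2 g3 t(11) by (subst path_image_join) auto
  ultimately show ?thesis using that[of "(g1 +++ g2) +++ g3"] g1 g3 by simp
qed

locale triangulated_sphere =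
  fixes T :: embedded_graph
  assumes tri: "sphere_triangulation T"
begin

lemma planar: "planar_map T"
  using tri by (simp add: sphere_triangulation_def)

lemma finite_verts: "finite (verts T)" and verts_sphere: "verts T \<subseteq> unit_sphere"
  by (fact planar_mapD(1,2)[OF planar])+

lemma edge_arc:
  assumes "e \<in> edges T"
  obtains a b where "a \<in> verts T" "b \<in> verts T" "open_arc a b e"
  using planar_mapD(3)[OF planar] assms by blast

lemma edge_not_vert: "e \<in> edges T \<Longrightarrow> x \<in> e \<Longrightarrow> x \<notin> verts T"
  using planar_mapD(4)[OF planar] by blast

lemma edges_disjoint: "e \<in> edges T \<Longrightarrow> e' \<in> edges T \<Longrightarrow> x \<in> e \<Longrightarrow> x \<in> e' \<Longrightarrow> e = e'"
  using planar_mapD(5)[OF planar] unfolding pairwise_def disjnt_def by blast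

lemma edge_nonempty: "e \<in> edges T \<Longrightarrow> e \<noteq> {}"
  using edge_arc open_arc_properties(5) by metis

lemma edge_connected: "e \<in> edges T \<Longrightarrow> connected e"
  using edge_arc open_arc_properties(6) by metis

lemma edge_closure:
  assumes "e \<in> edges T"
  shows "closure e \<subseteq> e \<union> verts T" "closure e \<subseteq> unit_sphere"
proof -
  obtain a b where "a \<in> verts T" "b \<in> verts T" "open_arc a b e" using edge_arc[OF assms] .
  then show "closure e \<subseteq> e \<union> verts T" "closure e \<subseteq> unit_sphere" using open_arc_properties(2,7) by auto
qed

lemma finite_edges: "finite (edges T)"
proof -
  have uniq: "e = e'" if "e \<in> edges T" "e' \<in> edges T" "open_arc a b e" "open_arc a b e'" for a b e e'
    using planar_mapD(6)[OF planar] that by blast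
  have "edges T \<subseteq> (\<lambda>(a, b). SOME e. e \<in> edges T \<and> open_arc a b e) ` (verts T \<times> verts T)"
  proof
    fix e assume e: "e \<in> edges T"
    then obtain a b where ab: "a \<in> verts T" "b \<in> verts T" "open_arc a b e" using edge_arc by blast
    have "(SOME e. e \<in> edges T \<and> open_arc a b e) = e"
      using e ab uniq by (intro some_equality) auto
    then show "e \<in> (\<lambda>(a, b). SOME e. e \<in> edges T \<and> open_arc a b e) ` (verts T \<times> verts T)"
      using ab by force
  qed
  then show ?thesis using finite_verts by (meson finite_SigmaI finite_imageI finite_subset)
qed

lemma compact_subskeleton:
  assumes "F \<subseteq> edges T"
  shows "compact (verts T \<union> \<Union>F)"
proof -
  have "verts T \<union> \<Union>F = verts T \<union> (\<Union>e\<in>F. closure e)"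
  proof -
    have "e \<subseteq> closure e" "closure e \<subseteq> e \<union> verts T" if "e \<in> F" for e
      using edge_closure(1)[of e] closure_subset that assms by blast+
    then show ?thesis by blast
  qed
  moreover have "compact (closure e)" if "e \<in> F" for e
  proof -
    have "closure e \<subseteq> unit_sphere" using edge_closure(2) that assms by blast
    then have "bounded (closure e)" using bounded_subset[OF bounded_sphere] by blast
    then show ?thesis by (simp add: compact_eq_bounded_closed)
  qed
  moreover have "finite F" using finite_edges assms finite_subset by blast
  moreover have "compact (verts T)" using finite_verts by (rule finite_imp_compact)
  ultimately show ?thesis using compact_UN[of F closure] by (simp add: compact_Un)
qed

lemma skeleton_sphere: "skeleton T \<subseteq> unit_sphere"
proof -
  have "e \<subseteq> unit_sphere" if "e \<in> edges T" for e
    using edge_closure(2)[OF that] closure_subset[of e] by (rule subset_trans[rotated])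
  then show ?thesis unfolding skeleton_def using verts_sphere by blast
qed

text \<open>Vertices and closed edges have empty interior, and there are finitely many of them.\<close>

lemma skeleton_empty_interior:
  assumes "openin (top_of_set unit_sphere) W" "W \<subseteq> skeleton T"
  shows "W = {}"
proof (rule empty_interior_finite_Union[OF _ _ _ assms(1)])
  let ?F = "(\<lambda>v. {v}) ` verts T \<union> closure ` edges T"
  show "finite ?F" using finite_verts finite_edges by simp
  have "skeleton T \<subseteq> \<Union>?F" unfolding skeleton_def using closure_subset by auto
  then show "W \<subseteq> \<Union>?F" using assms(2) by (rule subset_trans[rotated])
  fix A assume A: "A \<in> ?F"
  then show "closed A" by auto
  fix W' assume W': "openin (top_of_set unit_sphere) W'" "W' \<subseteq> A"
  from A show "W' = {}"
  proof
    assume "A \<in> (\<lambda>v. {v}) ` verts T"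
    then have "finite W'" using W'(2) by (auto intro: finite_subset)
    then show ?thesis using openin_sphere_infinite[OF W'(1)] by blast
  next
    assume "A \<in> closure ` edges T"
    then obtain e where "e \<in> edges T" "A = closure e" by blast
    then obtain g where "arc g" "path_image g = A" using edge_arc open_arc_properties(8) by metis
    then show ?thesis using arc_image_empty_interior W' by blast
  qed
qed

lemma face_open: "f \<in> faces T \<Longrightarrow> openin (top_of_set unit_sphere) f"
proof -
  assume f: "f \<in> faces T"
  have "open (- skeleton T)"
    unfolding skeleton_def using compact_subskeleton[of "edges T"] by (intro open_Compl compact_imp_closed) simp
  then have o: "openin (top_of_set unit_sphere) (unit_sphere - skeleton T)"
    by (metis Diff_eq openin_open_Int)
  moreover have "locally connected unit_sphere" by (rule locally_connected_sphere)
  ultimately have "locally connected (unit_sphere - skeleton T)" using locally_open_subset by blast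
  then have "openin (top_of_set (unit_sphere - skeleton T)) f"
    using f by (simp add: faces_def skeleton_def openin_components_locally_connected)
  then show ?thesis using o openin_trans by blast
qed

lemma face_connected: "f \<in> faces T \<Longrightarrow> connected f"
  and face_nonempty: "f \<in> faces T \<Longrightarrow> f \<noteq> {}"
  unfolding faces_def by (auto dest: in_components_connected in_components_nonempty)

lemma face_disjoint_skeleton: "f \<in> faces T \<Longrightarrow> x \<in> f \<Longrightarrow> x \<notin> skeleton T"
  unfolding faces_def skeleton_def by (auto dest!: in_components_subset)

lemma faces_disjoint: "f \<in> faces T \<Longrightarrow> g \<in> faces T \<Longrightarrow> x \<in> f \<Longrightarrow> x \<in> g \<Longrightarrow> f = g"
  unfolding faces_def using components_nonoverlap by blast

lemma Union_faces: "\<Union>(faces T) = unit_sphere - skeleton T"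
  unfolding faces_def skeleton_def by (simp add: Union_components)

lemma face_boundary: "f \<in> faces T \<Longrightarrow> sphere_boundary f = closure f - f"
  and face_closure_sphere: "f \<in> faces T \<Longrightarrow> closure f \<subseteq> unit_sphere"
  using sphere_boundary_open face_open by blast+

lemma face_triangle: "f \<in> faces T \<Longrightarrow> is_triangle T (closure f - f)"
  using tri face_boundary unfolding sphere_triangulation_def by metis

lemma triangle_skeleton: "is_triangle T B \<Longrightarrow> B \<subseteq> skeleton T"
  unfolding is_triangle_def skeleton_def by blast

lemma face_closure_skeleton:
  assumes "f \<in> faces T"
  shows "closure f \<subseteq> f \<union> skeleton T"
  using triangle_skeleton[OF face_triangle[OF assms]] by blast

text \<open>The boundary of a face is a Jordan curve. What lies beyond it is again connected and reaches
  every point of the curve.\<close>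

lemma face_other_side:
  assumes f: "f \<in> faces T"
  shows "openin (top_of_set unit_sphere) (unit_sphere - closure f)"
    "connected (unit_sphere - closure f)" "closure f - f \<subseteq> closure (unit_sphere - closure f)"
proof -
  obtain p where p: "simple_path p" "pathfinish p = pathstart p" "path_image p = closure f - f"
    using triangle_simple_closed_path[OF planar face_triangle[OF f]] .
  have eq: "unit_sphere - path_image p - f = unit_sphere - closure f"
    using p(3) closure_subset[of f] by auto
  have h: "path_image p \<subseteq> unit_sphere" "f \<inter> path_image p = {}" "closure f \<subseteq> f \<union> path_image p"
    using p(3) face_closure_sphere[OF f] by auto
  note * = jordan_disc_complement[OF p(1,2) h(1) face_open[OF f] face_connected[OF f] face_nonempty[OF f] h(2,3)]
  show "openin (top_of_set unit_sphere) (unit_sphere - closure f)"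
    "connected (unit_sphere - closure f)" "closure f - f \<subseteq> closure (unit_sphere - closure f)"
    using *[unfolded eq] p(3) by simp_all
qed

lemma face_outside_closure:
  assumes "f \<in> faces T" "g \<in> faces T" "f \<noteq> g"
  shows "g \<subseteq> unit_sphere - closure f"
proof
  fix x assume x: "x \<in> g"
  then have "x \<notin> skeleton T" "x \<notin> f" using assms face_disjoint_skeleton faces_disjoint by blast+
  then show "x \<in> unit_sphere - closure f"
    using x face_closure_skeleton[OF assms(1)] openin_imp_subset[OF face_open[OF assms(2)]] by blast
qed

text \<open>The face \<open>g\<close> is open and closed in the connected far side of \<open>f\<close>.\<close>

lemma same_boundary_faces:
  assumes f: "f \<in> faces T" and g: "g \<in> faces T" and "f \<noteq> g"
    and bd: "closure f - f = closure g - g"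
  shows "g = unit_sphere - closure f"
proof -
  let ?D = "unit_sphere - closure f"
  have "openin (top_of_set unit_sphere) (unit_sphere - closure g)" by (rule face_other_side(1)[OF g])
  then have "?D \<inter> g = {} \<or> ?D \<inter> (unit_sphere - closure g) = {}"
    using bd closure_subset[of g] by (intro connected_openin_split[OF face_other_side(2)[OF f] face_open[OF g]]) auto
  moreover have gD: "g \<subseteq> ?D" using face_outside_closure assms by blast
  ultimately have "?D \<subseteq> closure g" using face_nonempty[OF g] by blast
  then show ?thesis using gD bd closure_subset[of f] by blast
qed

text \<open>A triangle is determined by sets of vertices and edges, of which there are finitely many,
  and it bounds at most two faces.\<close>

lemma finite_faces: "finite (faces T)"
proof -
  let ?bd = "\<lambda>f. closure f - f"
  have "?bd ` faces T \<subseteq> (\<lambda>(A, F). A \<union> \<Union>F) ` (Pow (verts T) \<times> Pow (edges T))"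
  proof
    fix B assume "B \<in> ?bd ` faces T"
    then have "is_triangle T B" using face_triangle by blast
    then obtain u v w e1 e2 e3 where "{u, v, w} \<in> Pow (verts T)" "{e1, e2, e3} \<in> Pow (edges T)" "B = {u, v, w} \<union> e1 \<union> e2 \<union> e3"
      unfolding is_triangle_def by blast
    moreover from this have "B = {u, v, w} \<union> \<Union>{e1, e2, e3}" by auto
    ultimately show "B \<in> (\<lambda>(A, F). A \<union> \<Union>F) ` (Pow (verts T) \<times> Pow (edges T))"
      by (intro image_eqI[where x = "({u, v, w}, {e1, e2, e3})"]) auto
  qed
  then have fin: "finite (?bd ` faces T)"
    using finite_verts finite_edges by (meson finite_Pow_iff finite_SigmaI finite_imageI finite_subset)
  have "finite {g \<in> faces T. ?bd g = B}" for B
  proof (cases "\<exists>f\<in>faces T. ?bd f = B")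
    case True
    then obtain f where "f \<in> faces T" "?bd f = B" by blast
    then have "{g \<in> faces T. ?bd g = B} \<subseteq> {f, unit_sphere - closure f}"
      using same_boundary_faces by blast
    then show ?thesis by (rule finite_subset) simp
  next
    case False
    then have "{g \<in> faces T. ?bd g = B} = {}" by blast
    then show ?thesis by (metis finite.emptyI)
  qed
  then have "finite (\<Union>B\<in>?bd ` faces T. {g \<in> faces T. ?bd g = B})" using fin by blast
  moreover have "faces T \<subseteq> (\<Union>B\<in>?bd ` faces T. {g \<in> faces T. ?bd g = B})" by blast
  ultimately show ?thesis using finite_subset by blast
qed

end

section \<open>How faces meet at edges and vertices\<close>

context triangulated_sphere
begin

text \<open>The faces are dense because the skeleton has empty interior, and a finite union of closures
  is closed.\<close>

lemma faces_cover: "x \<in> unit_sphere \<Longrightarrow> \<exists>f\<in>faces T. x \<in> closure f"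
proof (rule ccontr)
  let ?C = "\<Union>f\<in>faces T. closure f"
  assume x: "x \<in> unit_sphere" "\<not> (\<exists>f\<in>faces T. x \<in> closure f)"
  have "closed ?C" using finite_faces by (intro closed_UN) auto
  then have o: "openin (top_of_set unit_sphere) (unit_sphere - ?C)"
    by (metis Diff_eq openin_open_Int open_Compl)
  have "\<Union>(faces T) \<subseteq> ?C" using closure_subset by auto
  then have "unit_sphere - ?C \<subseteq> skeleton T" using Union_faces by blast
  then have "unit_sphere - ?C = {}" using skeleton_empty_interior[OF o] by blast
  then show False using x by blast
qed

lemma edge_on_boundary:
  assumes "f \<in> faces T" "e \<in> edges T" "x \<in> e" "x \<in> closure f"
  shows "e \<subseteq> closure f - f"
proof -
  have "x \<notin> f" using face_disjoint_skeleton[OF assms(1), of x] assms(2,3) unfolding skeleton_def by blast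
  then have "e \<inter> (closure f - f) \<noteq> {}" using assms by blast
  then obtain u v w e2 e3 where "closure f - f = {u, v, w} \<union> e \<union> e2 \<union> e3"
    using triangle_from_edge[OF planar face_triangle[OF assms(1)] assms(2)] by metis
  then show ?thesis by blast
qed

lemma face_maximal:
  assumes "f \<in> faces T" "connected C" "C \<subseteq> unit_sphere - skeleton T" "x \<in> f" "x \<in> C"
  shows "C \<subseteq> f"
  using assms components_maximal[of f "unit_sphere - skeleton T" C] unfolding faces_def skeleton_def by blast

text \<open>This is where planarity enters. Let \<open>K\<close> be the skeleton without \<open>e\<close>, and \<open>B\<close> the boundary of
  \<open>g\<close>. The faces \<open>f\<close> and \<open>l\<close> can be joined without meeting \<open>K\<close>, by crossing \<open>e\<close>, and also without
  meeting \<open>B\<close>, on the far side of \<open>g\<close>. Since \<open>K \<inter> B\<close>, the union of the other two sides of \<open>g\<close>, is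
  connected, Janiszewski's theorem joins \<open>f\<close> and \<open>l\<close> without meeting \<open>K \<union> B\<close>, which is the whole
  skeleton; so they are one face. The pole of the chart lies in \<open>g\<close>, which both connections avoid.\<close>

lemma edge_not_three_faces:
  assumes e: "e \<in> edges T" and F: "f \<in> faces T" "g \<in> faces T" "l \<in> faces T"
    and ne: "f \<noteq> g" "l \<noteq> g" "f \<noteq> l"
    and ef: "e \<subseteq> closure f" "e \<subseteq> closure g" "e \<subseteq> closure l"
  shows False
proof -
  let ?B = "closure g - g"
  let ?K = "verts T \<union> \<Union>(edges T - {e})"
  have gdis: "x \<notin> skeleton T" if "x \<in> g" for x using face_disjoint_skeleton[OF F(2) that] .
  have eB: "e \<inter> ?B \<noteq> {}" using gdis ef(2) e edge_nonempty[OF e] unfolding skeleton_def by blast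
  obtain u v w e2 e3 where t: "u \<in> verts T" "v \<in> verts T" "w \<in> verts T" "e2 \<in> edges T" "e3 \<in> edges T"
    "distinct [u, v, w]" "open_arc u v e" "open_arc v w e2" "open_arc w u e3"
    "?B = {u, v, w} \<union> e \<union> e2 \<union> e3"
    by (rule triangle_from_edge[OF planar face_triangle[OF F(2)] e eB])
  have "e2 \<noteq> e" using open_arc_ends[of u v e v w] t by (auto simp: doubleton_eq_iff)
  moreover have "e3 \<noteq> e" using open_arc_ends[of u v e w u] t by (auto simp: doubleton_eq_iff)
  moreover have eK: "x \<notin> ?K" if "x \<in> e" for x
    using edges_disjoint[OF e _ that] edge_not_vert[OF e that] by blast
  ultimately have KB: "?K \<inter> ?B = closure e2 \<union> closure e3"
    unfolding open_arc_properties(2)[OF t(8)] open_arc_properties(2)[OF t(9)] t(10) using t(1-5) by blast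
  have "connected (closure e2 \<union> closure e3)"
  proof (rule connected_Un)
    show "connected (closure e2)" "connected (closure e3)"
      using edge_connected t(4,5) by (auto intro: connected_imp_connected_closure)
    show "closure e2 \<inter> closure e3 \<noteq> {}"
      unfolding open_arc_properties(2)[OF t(8)] open_arc_properties(2)[OF t(9)] by blast
  qed
  then have conKB: "connected (?K \<inter> ?B)" unfolding KB .
  have cK: "compact ?K" by (rule compact_subskeleton) blast
  have cB: "compact ?B"
  proof -
    obtain p where p: "simple_path p" "path_image p = ?B"
      using triangle_simple_closed_path[OF planar face_triangle[OF F(2)]] by metis
    then show ?thesis by (metis compact_simple_path_image)
  qed
  have sk: "?K \<union> ?B = skeleton T" unfolding t(10) skeleton_def using t(1-5) e by blast
  obtain z where z: "z \<in> g" using face_nonempty[OF F(2)] by blast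
  have zS: "z \<in> unit_sphere" using z openin_imp_subset[OF face_open[OF F(2)]] by blast
  obtain h k where hk: "homeomorphism (unit_sphere - {z}) (UNIV::complex set) h k"
    using punctured_sphere_chart[OF zS] .
  have kh: "\<And>x. x \<in> unit_sphere - {z} \<Longrightarrow> k (h x) = x" and hkx: "\<And>y. h (k y) = y"
    and kim: "range k = unit_sphere - {z}" and ck: "continuous_on UNIV k"
    and ch: "continuous_on (unit_sphere - {z}) h"
    using hk unfolding homeomorphism_def by auto
  have injh: "inj_on h (unit_sphere - {z})" using kh by (metis inj_onI)
  have skS: "skeleton T \<subseteq> unit_sphere - {z}" using skeleton_sphere gdis[OF z] by blast
  then have KS: "?K \<subseteq> unit_sphere - {z}" and BS: "?B \<subseteq> unit_sphere - {z}" using sk by blast+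
  have hKB: "h ` ?K \<inter> h ` ?B = h ` (?K \<inter> ?B)"
    using inj_on_image_Int[OF injh KS BS] by simp
  obtain x y where x: "x \<in> f" and y: "y \<in> l" using F face_nonempty by blast
  have fS: "f \<subseteq> unit_sphere - {z}" "l \<subseteq> unit_sphere - {z}"
    using openin_imp_subset[OF face_open[OF F(1)]] openin_imp_subset[OF face_open[OF F(3)]] z ne F faces_disjoint by blast+
  have comp: "connected_component (- (h ` A)) (h x) (h y)"
    if C: "connected C" "x \<in> C" "y \<in> C" "C \<subseteq> unit_sphere - {z}" and A: "A \<subseteq> unit_sphere - {z}" "A \<inter> C = {}" for A C
  proof -
    have "connected (h ` C)" using C ch by (meson connected_continuous_image continuous_on_subset)
    moreover have "h ` C \<subseteq> - (h ` A)" using injh C(4) A by (auto dest: inj_onD)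
    ultimately show ?thesis using C(2,3) unfolding connected_component_def by blast
  qed
  have "connected (f \<union> e \<union> l)"
  proof -
    have "connected (f \<union> e)"
      by (rule connected_intermediate_closure[OF face_connected[OF F(1)]]) (use ef(1) closure_subset[of f] in blast)+
    moreover have "connected (l \<union> e)"
      by (rule connected_intermediate_closure[OF face_connected[OF F(3)]]) (use ef(3) closure_subset[of l] in blast)+
    moreover have "(f \<union> e) \<inter> (l \<union> e) \<noteq> {}" using edge_nonempty[OF e] by blast
    ultimately have "connected ((f \<union> e) \<union> (l \<union> e))" by (rule connected_Un)
    moreover have "(f \<union> e) \<union> (l \<union> e) = f \<union> e \<union> l" by blast
    ultimately show ?thesis by simp
  qed
  moreover have "f \<union> e \<union> l \<subseteq> unit_sphere - {z}" using fS skS e unfolding skeleton_def by blast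
  moreover have "?K \<inter> (f \<union> e \<union> l) = {}"
    using eK face_disjoint_skeleton[OF F(1)] face_disjoint_skeleton[OF F(3)] sk by blast
  ultimately have 1: "connected_component (- (h ` ?K)) (h x) (h y)"
    using x y KS by (intro comp) auto
  have 2: "connected_component (- (h ` ?B)) (h x) (h y)"
  proof (rule comp[OF face_other_side(2)[OF F(2)]])
    show "x \<in> unit_sphere - closure g" "y \<in> unit_sphere - closure g"
      using face_outside_closure[OF F(2,1)] face_outside_closure[OF F(2,3)] ne x y by blast+
    show "?B \<inter> (unit_sphere - closure g) = {}" by blast
    show "unit_sphere - closure g \<subseteq> unit_sphere - {z}" using z closure_subset by blast
  qed (rule BS)
  have "connected_component (- (h ` ?K \<union> h ` ?B)) (h x) (h y)"
  proof (rule Janiszewski[OF _ _ _ 1 2])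
    show "compact (h ` ?K)" using cK KS ch by (meson compact_continuous_image continuous_on_subset)
    have "compact (h ` ?B)" using cB BS ch by (meson compact_continuous_image continuous_on_subset)
    then show "closed (h ` ?B)" by (rule compact_imp_closed)
    have "?K \<inter> ?B \<subseteq> unit_sphere - {z}" using KS by blast
    then show "connected (h ` ?K \<inter> h ` ?B)"
      unfolding hKB using conKB ch by (meson connected_continuous_image continuous_on_subset)
  qed
  then have "connected_component (- (h ` skeleton T)) (h x) (h y)"
    unfolding sk[symmetric] by (simp only: image_Un)
  then obtain C where C: "connected C" "C \<subseteq> - (h ` skeleton T)" "h x \<in> C" "h y \<in> C"
    unfolding connected_component_def by blast
  have "connected (k ` C)" using C(1) ck by (meson connected_continuous_image continuous_on_subset subset_UNIV)
  moreover have "k ` C \<subseteq> unit_sphere - skeleton T"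
  proof
    fix a assume "a \<in> k ` C"
    then obtain c where c: "c \<in> C" "a = k c" by blast
    then have "h a \<notin> h ` skeleton T" using C(2) hkx by auto
    then show "a \<in> unit_sphere - skeleton T" using c kim by blast
  qed
  moreover have "x \<in> k ` C" "y \<in> k ` C"
    using kh[of x] kh[of y] x y fS C(3,4) by (metis image_eqI subsetD)+
  ultimately have "y \<in> f" using face_maximal[OF F(1)] x by blast
  then show False using faces_disjoint[OF F(1,3) _ y] ne(3) by blast
qed

text \<open>A second face exists because a point of \<open>e\<close> lies in the closure of the far side of the first
  one, and the far side is covered by the closures of the other faces.\<close>

lemma edge_two_faces:
  assumes e: "e \<in> edges T"
  shows "card {f \<in> faces T. e \<subseteq> closure f} = 2"
proof -
  obtain p where p: "p \<in> e" using edge_nonempty[OF e] by blast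
  have "p \<in> unit_sphere" using p edge_closure(2)[OF e] closure_subset by blast
  then obtain f where f: "f \<in> faces T" "p \<in> closure f" using faces_cover by blast
  then have ef: "e \<subseteq> closure f - f" using edge_on_boundary e p by blast
  let ?C = "\<Union>g\<in>faces T - {f}. closure g"
  have "closed ?C" using finite_faces by (intro closed_UN) auto
  moreover have "unit_sphere - closure f \<subseteq> ?C" using faces_cover by blast
  ultimately have "closure (unit_sphere - closure f) \<subseteq> ?C" by (rule closure_minimal[rotated])
  then have "p \<in> ?C" using face_other_side(3)[OF f(1)] ef p by blast
  then obtain g where g: "g \<in> faces T" "g \<noteq> f" "p \<in> closure g" by blast
  then have eg: "e \<subseteq> closure g" using edge_on_boundary e p by blast
  have "{f \<in> faces T. e \<subseteq> closure f} = {f, g}"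
    using f(1) g ef eg edge_not_three_faces[OF e f(1) g(1)] by blast
  then show ?thesis using g(2) by simp
qed

text \<open>Away from the vertices, a point in the closures of two different faces lies on an edge
  common to both. If \<open>A\<close> is closed under crossing the edges that meet \<open>C\<close>, the closures of the
  faces in \<open>A\<close> and of the remaining ones therefore cut \<open>C\<close> into two disjoint closed parts. The
  connectedness of the faces at a vertex and of the faces of the whole sphere are two instances.\<close>

lemma face_classes_exhaust:
  assumes C: "connected C" "C \<subseteq> unit_sphere" "C \<inter> verts T = {}"
    and F: "F \<subseteq> faces T" "C \<subseteq> (\<Union>f\<in>F. closure f)" "\<And>f. f \<in> F \<Longrightarrow> closure f \<inter> C \<noteq> {}"
    and A: "A \<subseteq> F" "A \<noteq> {}"
      "\<And>e f g. e \<in> edges T \<Longrightarrow> e \<inter> C \<noteq> {} \<Longrightarrow> f \<in> A \<Longrightarrow> g \<in> F \<Longrightarrow> e \<subseteq> closure f \<Longrightarrow> e \<subseteq> closure g \<Longrightarrow> g \<in> A"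
  shows "A = F"
proof (rule ccontr)
  assume "A \<noteq> F"
  then obtain f0 where f0: "f0 \<in> F - A" using A(1) by blast
  let ?P = "\<Union>f\<in>A. closure f" and ?Q = "\<Union>f\<in>F - A. closure f"
  have fin: "finite F" using F(1) finite_faces finite_subset by blast
  have "closed ?P" "closed ?Q" using fin A(1) by (auto intro!: closed_UN intro: finite_subset)
  moreover have "C \<subseteq> ?P \<union> ?Q" using F(2) by blast
  moreover have "?P \<inter> ?Q \<inter> C = {}"
  proof (rule ccontr)
    assume "?P \<inter> ?Q \<inter> C \<noteq> {}"
    then obtain x f g where x: "x \<in> C" "f \<in> A" "g \<in> F" "g \<notin> A" "x \<in> closure f" "x \<in> closure g" by blast
    then have ff: "f \<in> faces T" "g \<in> faces T" using A(1) F(1) by blast+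
    show False
    proof (cases "x \<in> skeleton T")
      case True
      then obtain e where e: "e \<in> edges T" "x \<in> e" using x(1) C(3) unfolding skeleton_def by blast
      have "e \<subseteq> closure f" "e \<subseteq> closure g"
        using edge_on_boundary[OF ff(1) e x(5)] edge_on_boundary[OF ff(2) e x(6)] by blast+
      then show False using A(3)[OF e(1) _ x(2,3)] x(1,4) e(2) by blast
    next
      case False
      then have "x \<in> f" "x \<in> g" using face_closure_skeleton ff x by blast+
      then show False using faces_disjoint[OF ff] x by blast
    qed
  qed
  moreover obtain f1 where "f1 \<in> A" using A(2) by blast
  then have "?P \<inter> C \<noteq> {}" using F(3)[of f1] A(1) by blast
  moreover have "?Q \<inter> C \<noteq> {}" using F(3)[of f0] f0 by blast
  ultimately show False using C(1) unfolding connected_closed by blast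
qed

text \<open>Here the connected set is a punctured disc about \<open>v\<close>, so small that it meets only cells
  incident with \<open>v\<close>.\<close>

lemma vertex_faces_connected:
  assumes v: "v \<in> verts T"
    and A: "A \<subseteq> {f \<in> faces T. v \<in> closure f}" "A \<noteq> {}"
      "\<And>e f g. e \<in> edges T \<Longrightarrow> v \<in> closure e \<Longrightarrow> f \<in> A \<Longrightarrow> g \<in> faces T \<Longrightarrow> e \<subseteq> closure f \<Longrightarrow> e \<subseteq> closure g \<Longrightarrow> g \<in> A"
  shows "A = {f \<in> faces T. v \<in> closure f}"
proof -
  \<comment> \<open>All closed cells that avoid \<open>v\<close>.\<close>
  define R where "R = (verts T - {v}) \<union> (\<Union>e\<in>{e \<in> edges T. v \<notin> closure e}. closure e) \<union> (\<Union>f\<in>{f \<in> faces T. v \<notin> closure f}. closure f)"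
  have "closed R" unfolding R_def
    using finite_verts finite_edges finite_faces by (intro closed_Un closed_UN finite_imp_closed) auto
  then have W: "openin (top_of_set unit_sphere) (unit_sphere - R)"
    by (metis Diff_eq openin_open_Int open_Compl)
  have "v \<in> unit_sphere - R" using v verts_sphere unfolding R_def by blast
  then obtain N where N: "openin (top_of_set unit_sphere) N" "v \<in> N" "N \<subseteq> unit_sphere - R" "\<And>q. connected (N - {q})"
    using small_disc_minus_point_connected[OF W] by metis
  show ?thesis
  proof (rule face_classes_exhaust[where C = "N - {v}"])
    show "connected (N - {v})" by (rule N(4))
    show "N - {v} \<subseteq> unit_sphere" using N(3) by blast
    show "(N - {v}) \<inter> verts T = {}" using N(3) unfolding R_def by blast
    show "N - {v} \<subseteq> (\<Union>f\<in>{f \<in> faces T. v \<in> closure f}. closure f)"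
    proof
      fix x assume x: "x \<in> N - {v}"
      then obtain f where f: "f \<in> faces T" "x \<in> closure f" using faces_cover N(3) by blast
      then have "v \<in> closure f" using x N(3) unfolding R_def by blast
      then show "x \<in> (\<Union>f\<in>{f \<in> faces T. v \<in> closure f}. closure f)" using f by blast
    qed
    show "closure f \<inter> (N - {v}) \<noteq> {}" if f: "f \<in> {f \<in> faces T. v \<in> closure f}" for f
    proof -
      obtain U where U: "open U" "N = unit_sphere \<inter> U" using N(1) unfolding openin_open by blast
      then have "U \<inter> closure f \<noteq> {}" using N(2) f by blast
      then have "U \<inter> f \<noteq> {}" using U(1) open_Int_closure_eq_empty by blast
      then obtain x where x: "x \<in> U" "x \<in> f" by blast
      have "x \<noteq> v" using face_disjoint_skeleton[of f x] f x v unfolding skeleton_def by blast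
      moreover have "x \<in> unit_sphere" using x f openin_imp_subset[OF face_open] by blast
      ultimately show ?thesis using x U(2) closure_subset by blast
    qed
    show "g \<in> A" if "e \<in> edges T" "e \<inter> (N - {v}) \<noteq> {}" "f \<in> A" "g \<in> {f \<in> faces T. v \<in> closure f}"
      "e \<subseteq> closure f" "e \<subseteq> closure g" for e f g
    proof -
      have "v \<in> closure e" using that(1,2) N(3) closure_subset[of e] unfolding R_def by blast
      then show ?thesis using A(3) that by blast
    qed
  qed (use A in auto)
qed

text \<open>With the pole at a vertex, this is the plane without finitely many points.\<close>

lemma sphere_minus_verts_connected: "connected (unit_sphere - verts T)"
proof -
  have "verts T \<noteq> {}" using tri unfolding sphere_triangulation_def by auto
  then obtain z where z: "z \<in> verts T" by blast
  then obtain h k where hk: "homeomorphism (unit_sphere - {z}) (UNIV::complex set) h k"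
    using punctured_sphere_chart verts_sphere by blast
  have kh: "\<And>x. x \<in> unit_sphere - {z} \<Longrightarrow> k (h x) = x" and hkx: "\<And>y. h (k y) = y"
    and kim: "range k = unit_sphere - {z}" and ck: "continuous_on UNIV k"
    using hk unfolding homeomorphism_def by auto
  have "connected (UNIV - h ` (verts T - {z}))"
    using finite_verts by (intro connected_open_delete_finite) auto
  then have "connected (k ` (UNIV - h ` (verts T - {z})))"
    using ck by (meson connected_continuous_image continuous_on_subset subset_UNIV)
  moreover have "k ` (UNIV - h ` (verts T - {z})) = unit_sphere - verts T"
  proof (intro equalityI subsetI)
    fix a assume "a \<in> k ` (UNIV - h ` (verts T - {z}))"
    then obtain c where c: "a = k c" "c \<notin> h ` (verts T - {z})" by blast
    then have "a \<notin> verts T - {z}" using hkx[of c] by (metis image_eqI)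
    moreover have "a \<in> unit_sphere - {z}" using c kim by blast
    ultimately show "a \<in> unit_sphere - verts T" by blast
  next
    fix a assume a: "a \<in> unit_sphere - verts T"
    then have az: "a \<in> unit_sphere - {z}" using z by blast
    have "h a \<notin> h ` (verts T - {z})"
    proof
      assume "h a \<in> h ` (verts T - {z})"
      then obtain b where b: "b \<in> verts T - {z}" "h a = h b" by blast
      then have "a = b" using kh[OF az] kh[of b] verts_sphere by (metis Diff_iff subsetD)
      then show False using a b by blast
    qed
    then show "a \<in> k ` (UNIV - h ` (verts T - {z}))" using kh[OF az] by (intro image_eqI[where x = "h a"]) auto
  qed
  ultimately show ?thesis by simp
qed

lemma faces_strongly_connected:
  assumes A: "A \<subseteq> faces T" "A \<noteq> {}"
      "\<And>e f g. e \<in> edges T \<Longrightarrow> f \<in> A \<Longrightarrow> g \<in> faces T \<Longrightarrow> e \<subseteq> closure f \<Longrightarrow> e \<subseteq> closure g \<Longrightarrow> g \<in> A"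
  shows "A = faces T"
proof (rule face_classes_exhaust[OF sphere_minus_verts_connected])
  show "unit_sphere - verts T \<subseteq> (\<Union>f\<in>faces T. closure f)" using faces_cover by blast
  show "closure f \<inter> (unit_sphere - verts T) \<noteq> {}" if f: "f \<in> faces T" for f
  proof -
    obtain x where "x \<in> f" using face_nonempty[OF f] by blast
    then show ?thesis using closure_subset[of f] face_disjoint_skeleton[OF f, of x] openin_imp_subset[OF face_open[OF f]]
      unfolding skeleton_def by blast
  qed
  show "g \<in> A" if "e \<in> edges T" "e \<inter> (unit_sphere - verts T) \<noteq> {}" "f \<in> A" "g \<in> faces T"
      "e \<subseteq> closure f" "e \<subseteq> closure g" for e f g
    using A(3) that by blast
qed (use A in auto)

end

section \<open>Incidence and the link of a cell\<close>

lemma incident_sym: "incident T x y \<longleftrightarrow> incident T y x"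
  unfolding incident_def by metis

context triangulated_sphere
begin

lemma sphere_boundary_bounds:
  assumes "closure C \<subseteq> unit_sphere"
  shows "closure C - C \<subseteq> sphere_boundary C" "sphere_boundary C \<subseteq> closure C"
proof -
  have "C \<subseteq> unit_sphere" using assms closure_subset by blast
  then have "top_of_set unit_sphere closure_of C = closure C"
    using assms by (auto simp: closure_of_subtopology inf_absorb2)
  then show "closure C - C \<subseteq> sphere_boundary C" "sphere_boundary C \<subseteq> closure C"
    using interior_of_subset[of "top_of_set unit_sphere" C] unfolding frontier_of_def by blast+
qed

lemma vertex_boundary: "v \<in> verts T \<Longrightarrow> sphere_boundary {v} \<subseteq> {v}"
proof -
  assume v: "v \<in> verts T"
  have c: "closure {v} = {v}" by simp
  have "closure {v} \<subseteq> unit_sphere" unfolding c using v verts_sphere by blast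
  then show ?thesis using sphere_boundary_bounds(2)[of "{v}"] unfolding c by blast
qed

lemma face_not_vert: "f \<in> faces T \<Longrightarrow> x \<in> f \<Longrightarrow> x \<notin> verts T"
  and face_not_edge: "f \<in> faces T \<Longrightarrow> e \<in> edges T \<Longrightarrow> x \<in> f \<Longrightarrow> x \<notin> e"
  using face_disjoint_skeleton[of f x] unfolding skeleton_def by blast+

lemma dim_vertex: "v \<in> verts T \<Longrightarrow> cell_dim T {v} = 0"
  by (simp add: cell_dim_def vertex_cells_def)

lemma dim_edge: "e \<in> edges T \<Longrightarrow> cell_dim T e = 1"
proof -
  assume e: "e \<in> edges T"
  have "e \<notin> vertex_cells T" using edge_not_vert[OF e] unfolding vertex_cells_def by blast
  then show ?thesis using e by (simp add: cell_dim_def)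
qed

lemma dim_face: "f \<in> faces T \<Longrightarrow> cell_dim T f = 2"
proof -
  assume f: "f \<in> faces T"
  have "f \<notin> vertex_cells T" using face_not_vert[OF f] unfolding vertex_cells_def by blast
  moreover have "f \<notin> edges T" using face_not_edge[OF f] face_nonempty[OF f] by blast
  ultimately show ?thesis by (simp add: cell_dim_def)
qed

lemma cells_cases:
  assumes "c \<in> cells T"
  obtains v where "v \<in> verts T" "c = {v}" | "c \<in> edges T" | "c \<in> faces T"
  using assms unfolding cells_def vertex_cells_def by blast

lemma cellsI: "v \<in> verts T \<Longrightarrow> {v} \<in> cells T" "e \<in> edges T \<Longrightarrow> e \<in> cells T" "f \<in> faces T \<Longrightarrow> f \<in> cells T"
  unfolding cells_def vertex_cells_def by blast+

lemma incident_vertex_edge: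
  assumes v: "v \<in> verts T" and e: "e \<in> edges T"
  shows "incident T {v} e \<longleftrightarrow> v \<in> closure e"
proof -
  have "v \<notin> e" using edge_not_vert e v by blast
  then have "{v} \<subseteq> sphere_boundary e \<longleftrightarrow> v \<in> closure e"
    using sphere_boundary_bounds[OF edge_closure(2)[OF e]] by blast
  moreover have "\<not> e \<subseteq> sphere_boundary {v}"
    using vertex_boundary[OF v] edge_nonempty[OF e] \<open>v \<notin> e\<close> by blast
  ultimately show ?thesis using cellsI v e by (simp add: incident_def dim_vertex dim_edge)
qed

lemma incident_vertex_face:
  assumes v: "v \<in> verts T" and f: "f \<in> faces T"
  shows "incident T {v} f \<longleftrightarrow> v \<in> closure f"
proof -
  have "v \<notin> f" using face_not_vert f v by blast
  then have "{v} \<subseteq> sphere_boundary f \<longleftrightarrow> v \<in> closure f"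
    using face_boundary[OF f] by blast
  moreover have "\<not> f \<subseteq> sphere_boundary {v}"
    using vertex_boundary[OF v] face_nonempty[OF f] \<open>v \<notin> f\<close> by blast
  ultimately show ?thesis using cellsI v f by (simp add: incident_def dim_vertex dim_face)
qed

lemma incident_edge_face:
  assumes e: "e \<in> edges T" and f: "f \<in> faces T"
  shows "incident T e f \<longleftrightarrow> e \<subseteq> closure f"
proof -
  have "e \<inter> f = {}" using face_not_edge f e by blast
  then have "e \<subseteq> sphere_boundary f \<longleftrightarrow> e \<subseteq> closure f"
    using face_boundary[OF f] by blast
  moreover have "\<not> f \<subseteq> sphere_boundary e"
    using sphere_boundary_bounds(2)[OF edge_closure(2)[OF e]] edge_closure(1)[OF e] face_not_vert[OF f]
      face_nonempty[OF f] \<open>e \<inter> f = {}\<close> by blast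
  ultimately show ?thesis using cellsI e f by (simp add: incident_def dim_edge dim_face)
qed

lemma not_incident_same_dim: "cell_dim T x = cell_dim T y \<Longrightarrow> \<not> incident T x y"
  unfolding incident_def by simp

lemma incident_cells: "incident T x y \<Longrightarrow> x \<in> cells T \<and> y \<in> cells T"
  unfolding incident_def by simp

text \<open>Together with the next two lemmas this turns incidence into a relation between closures, in
  which all further arguments about links are carried out.\<close>

lemma vertex_link:
  assumes v: "v \<in> verts T"
  shows "incident T {v} y \<longleftrightarrow> y \<in> edges T \<and> v \<in> closure y \<or> y \<in> faces T \<and> v \<in> closure y"
proof
  assume i: "incident T {v} y"
  then have "y \<in> cells T" using incident_cells by blast
  then show "y \<in> edges T \<and> v \<in> closure y \<or> y \<in> faces T \<and> v \<in> closure y"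
  proof (cases rule: cells_cases)
    case (1 w)
    then show ?thesis using not_incident_same_dim[of "{v}" y] i v by (simp add: dim_vertex)
  qed (use i v incident_vertex_edge incident_vertex_face in blast)+
qed (use incident_vertex_edge[OF v] incident_vertex_face[OF v] in blast)

lemma edge_link:
  assumes e: "e \<in> edges T"
  shows "incident T e y \<longleftrightarrow> (\<exists>v\<in>verts T. v \<in> closure e \<and> y = {v}) \<or> y \<in> faces T \<and> e \<subseteq> closure y"
proof
  assume i: "incident T e y"
  then have "y \<in> cells T" using incident_cells by blast
  then show "(\<exists>v\<in>verts T. v \<in> closure e \<and> y = {v}) \<or> y \<in> faces T \<and> e \<subseteq> closure y"
  proof (cases rule: cells_cases)
    case (1 v)
    then show ?thesis using incident_vertex_edge[OF 1(1) e] i incident_sym[of T e y] by blast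
  next
    case 2
    then show ?thesis using not_incident_same_dim[of e y] i e by (simp add: dim_edge)
  next
    case 3
    then show ?thesis using incident_edge_face[OF e 3] i by blast
  qed
next
  assume "(\<exists>v\<in>verts T. v \<in> closure e \<and> y = {v}) \<or> y \<in> faces T \<and> e \<subseteq> closure y"
  then show "incident T e y"
    using incident_vertex_edge[OF _ e] incident_edge_face[OF e] incident_sym by blast
qed

lemma face_link:
  assumes f: "f \<in> faces T"
  shows "incident T f y \<longleftrightarrow> (\<exists>v\<in>verts T. v \<in> closure f \<and> y = {v}) \<or> y \<in> edges T \<and> y \<subseteq> closure f"
proof
  assume i: "incident T f y"
  then have "y \<in> cells T" using incident_cells by blast
  then show "(\<exists>v\<in>verts T. v \<in> closure f \<and> y = {v}) \<or> y \<in> edges T \<and> y \<subseteq> closure f"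
  proof (cases rule: cells_cases)
    case (1 v)
    then show ?thesis using incident_vertex_face[OF 1(1) f] i incident_sym[of T f y] by blast
  next
    case 2
    then show ?thesis using incident_edge_face[OF 2 f] i incident_sym[of T f y] by blast
  next
    case 3
    then show ?thesis using not_incident_same_dim[of f y] i f by (simp add: dim_face)
  qed
next
  assume "(\<exists>v\<in>verts T. v \<in> closure f \<and> y = {v}) \<or> y \<in> edges T \<and> y \<subseteq> closure f"
  then show "incident T f y"
    using incident_vertex_face[OF _ f] incident_edge_face[OF _ f] incident_sym by blast
qed

lemma edge_ends:
  assumes e: "e \<in> edges T" "a \<in> verts T" "b \<in> verts T" "open_arc a b e"
  shows "verts T \<inter> closure e = {a, b}"
  using open_arc_properties(2)[OF e(4)] edge_not_vert[OF e(1)] e(2,3) by blast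

lemma edge_endpoints:
  assumes e: "e \<in> edges T"
  obtains a b where "a \<noteq> b" "verts T \<inter> closure e = {a, b}"
proof -
  obtain a b where ab: "a \<in> verts T" "b \<in> verts T" "open_arc a b e" using edge_arc[OF e] .
  then show ?thesis using that open_arc_properties(1)[OF ab(3)] edge_ends[OF e ab] by blast
qed

lemma face_corners_and_sides:
  assumes f: "f \<in> faces T"
  obtains u v w e1 e2 e3 where "distinct [u, v, w]" "verts T \<inter> closure f = {u, v, w}"
    "distinct [e1, e2, e3]" "{e \<in> edges T. e \<subseteq> closure f} = {e1, e2, e3}"
    "verts T \<inter> closure e1 = {u, v}" "verts T \<inter> closure e2 = {v, w}" "verts T \<inter> closure e3 = {w, u}"
proof -
  let ?B = "closure f - f"
  obtain u v w e1 e2 e3 where t: "u \<in> verts T" "v \<in> verts T" "w \<in> verts T"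
    "e1 \<in> edges T" "e2 \<in> edges T" "e3 \<in> edges T"
    "distinct [u, v, w]" "open_arc u v e1" "open_arc v w e2" "open_arc w u e3"
    "?B = {u, v, w} \<union> e1 \<union> e2 \<union> e3"
    using face_triangle[OF f] unfolding is_triangle_def by blast
  have ends: "verts T \<inter> closure e1 = {u, v}" "verts T \<inter> closure e2 = {v, w}" "verts T \<inter> closure e3 = {w, u}"
    by (rule edge_ends; fact)+
  have "x \<in> {u, v, w}" if x: "x \<in> verts T" "x \<in> closure f" for x
  proof -
    have "x \<in> ?B" using x face_not_vert[OF f, of x] by blast
    then show ?thesis using t(11) x(1) edge_not_vert[OF t(4)] edge_not_vert[OF t(5)] edge_not_vert[OF t(6)] by blast
  qed
  moreover have "{u, v, w} \<subseteq> verts T \<inter> closure f" using t(1-3,11) by blast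
  ultimately have uvw: "verts T \<inter> closure f = {u, v, w}" by blast
  have "e1 \<noteq> e2" using open_arc_ends[of u v e1 v w] t(7-10) by (auto simp: doubleton_eq_iff)
  moreover have "e1 \<noteq> e3" using open_arc_ends[of u v e1 w u] t(7-10) by (auto simp: doubleton_eq_iff)
  moreover have "e2 \<noteq> e3" using open_arc_ends[of v w e2 w u] t(7-10) by (auto simp: doubleton_eq_iff)
  ultimately have d: "distinct [e1, e2, e3]" by simp
  have "{e \<in> edges T. e \<subseteq> closure f} = {e1, e2, e3}"
  proof (intro equalityI subsetI)
    fix e assume "e \<in> {e \<in> edges T. e \<subseteq> closure f}"
    then have e: "e \<in> edges T" "e \<subseteq> closure f" by auto
    obtain x where x: "x \<in> e" using edge_nonempty[OF e(1)] by blast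
    then have "x \<in> ?B" using e face_not_edge[OF f e(1)] by blast
    then have "x \<in> {u, v, w} \<union> e1 \<union> e2 \<union> e3" unfolding t(11) .
    then have "x \<in> e1 \<or> x \<in> e2 \<or> x \<in> e3" using t(1-3) edge_not_vert[OF e(1) x] by blast
    then show "e \<in> {e1, e2, e3}" using edges_disjoint[OF e(1) _ x] t(4-6) by blast
  next
    fix e assume "e \<in> {e1, e2, e3}"
    moreover from this have "e \<subseteq> ?B" unfolding t(11) by blast
    ultimately show "e \<in> {e \<in> edges T. e \<subseteq> closure f}" using t(4-6) by blast
  qed
  then show ?thesis using that[OF t(7) uvw d _ ends] by blast
qed

definition between :: "(real^3) set \<Rightarrow> (real^3) set \<Rightarrow> (real^3) set set" where
  "between x y = {z. incident T x z \<and> incident T y z}"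

lemma between_sym: "between x y = between y x"
  unfolding between_def by blast

lemma between_vertex_edge:
  assumes v: "v \<in> verts T" and e: "e \<in> edges T" and i: "v \<in> closure e"
  shows "between {v} e = {f \<in> faces T. e \<subseteq> closure f}"
proof -
  have "v \<in> closure f" if "e \<subseteq> closure f" for f using that i closure_minimal[OF that] by auto
  moreover have "z \<in> faces T" if "z \<in> between {v} e" for z
  proof -
    have "z \<in> edges T \<or> z \<in> faces T" using that vertex_link[OF v] unfolding between_def by blast
    moreover have "z \<notin> edges T" using that not_incident_same_dim[of e z] e dim_edge unfolding between_def by auto
    ultimately show ?thesis by blast
  qed
  ultimately show ?thesis
    using incident_vertex_face[OF v] incident_edge_face[OF e] unfolding between_def by blast
qed

lemma between_edge_face:
  assumes e: "e \<in> edges T" and f: "f \<in> faces T" and i: "e \<subseteq> closure f"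
  shows "between e f = (\<lambda>v. {v}) ` (verts T \<inter> closure e)"
proof -
  have "closure e \<subseteq> closure f" using closure_minimal[OF i] by simp
  moreover have "z \<in> (\<lambda>v. {v}) ` (verts T \<inter> closure e)" if "z \<in> between e f" for z
  proof -
    have "z \<notin> faces T" using that not_incident_same_dim[of f z] f dim_face unfolding between_def by auto
    then show ?thesis using that edge_link[OF e, of z] unfolding between_def by blast
  qed
  ultimately show ?thesis
    using edge_link[OF e] face_link[OF f] unfolding between_def by blast
qed

lemma between_vertex_face:
  assumes v: "v \<in> verts T" and f: "f \<in> faces T"
  shows "between {v} f = {e \<in> {e \<in> edges T. e \<subseteq> closure f}. v \<in> verts T \<inter> closure e}"
proof -
  have "z \<in> edges T" if "z \<in> between {v} f" for z
  proof -
    have "z \<in> edges T \<or> z \<in> faces T" using that vertex_link[OF v] unfolding between_def by blast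
    moreover have "z \<notin> faces T" using that not_incident_same_dim[of f z] f dim_face unfolding between_def by auto
    ultimately show ?thesis by blast
  qed
  moreover have "incident T {v} z \<longleftrightarrow> v \<in> verts T \<inter> closure z" "incident T f z \<longleftrightarrow> z \<subseteq> closure f" if "z \<in> edges T" for z
    using incident_vertex_edge[OF v that] incident_edge_face[OF that f] incident_sym[of T f z] v by auto
  ultimately show ?thesis unfolding between_def by blast
qed

lemma card_between_vertex_face:
  assumes v: "v \<in> verts T" and f: "f \<in> faces T" and i: "v \<in> closure f"
  shows "card (between {v} f) = 2"
proof -
  obtain u1 u2 u3 e1 e2 e3 where t: "distinct [u1, u2, u3]" "verts T \<inter> closure f = {u1, u2, u3}"
    "distinct [e1, e2, e3]" "{e \<in> edges T. e \<subseteq> closure f} = {e1, e2, e3}"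
    "verts T \<inter> closure e1 = {u1, u2}" "verts T \<inter> closure e2 = {u2, u3}" "verts T \<inter> closure e3 = {u3, u1}"
    using face_corners_and_sides[OF f] .
  define P where "P e \<longleftrightarrow> v \<in> verts T \<inter> closure e" for e
  have b: "between {v} f = {e \<in> {e1, e2, e3}. P e}"
    unfolding between_vertex_face[OF v f] t(4) P_def ..
  have P: "P e1 \<longleftrightarrow> v = u1 \<or> v = u2" "P e2 \<longleftrightarrow> v = u2 \<or> v = u3" "P e3 \<longleftrightarrow> v = u3 \<or> v = u1"
    unfolding P_def t(5-7) by blast+
  have "v \<in> {u1, u2, u3}" using v i t(2) by blast
  then consider "v = u1" | "v = u2" | "v = u3" by blast
  then have "between {v} f = {e1, e3} \<or> between {v} f = {e1, e2} \<or> between {v} f = {e2, e3}"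
  proof cases
    case 1
    then have "P e1" "\<not> P e2" "P e3" using P t(1) by auto
    then show ?thesis unfolding b by blast
  next
    case 2
    then have "P e1" "P e2" "\<not> P e3" using P t(1) by auto
    then show ?thesis unfolding b by blast
  next
    case 3
    then have "\<not> P e1" "P e2" "P e3" using P t(1) by auto
    then show ?thesis unfolding b by blast
  qed
  then show ?thesis using t(3) by (elim disjE) simp_all
qed

text \<open>The diamond property. It says that in the link of a cell every element has exactly two
  neighbours, and it is also what lets an automorphism that fixes three mutually incident cells
  fix their neighbours.\<close>

lemma card_between:
  assumes "incident T x y"
  shows "card (between x y) = 2"
proof -
  have ve: "card (between {v} e) = 2" if "v \<in> verts T" "e \<in> edges T" "v \<in> closure e" for v e
    using between_vertex_edge that edge_two_faces by simp
  have ef: "card (between e f) = 2" if ef: "e \<in> edges T" "f \<in> faces T" "e \<subseteq> closure f" for e f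
  proof -
    obtain a b where "a \<noteq> b" "verts T \<inter> closure e = {a, b}" using edge_endpoints[OF ef(1)] .
    then show ?thesis using between_edge_face[OF ef] by simp
  qed
  have "x \<in> cells T" using incident_cells assms by blast
  then show ?thesis
  proof (cases rule: cells_cases)
    case (1 v)
    then have "y \<in> edges T \<and> v \<in> closure y \<or> y \<in> faces T \<and> v \<in> closure y"
      using vertex_link[OF 1(1), of y] assms by simp
    then show ?thesis using ve[OF 1(1)] card_between_vertex_face[OF 1(1)] unfolding 1(2) by blast
  next
    case 2
    then have "(\<exists>v\<in>verts T. v \<in> closure x \<and> y = {v}) \<or> y \<in> faces T \<and> x \<subseteq> closure y"
      using edge_link[OF 2, of y] assms by simp
    then show ?thesis using ve[OF _ 2] ef[OF 2] between_sym[of x "{v}" for v] by auto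
  next
    case 3
    then have "(\<exists>v\<in>verts T. v \<in> closure x \<and> y = {v}) \<or> y \<in> edges T \<and> y \<subseteq> closure x"
      using face_link[OF 3, of y] assms by simp
    then show ?thesis using card_between_vertex_face[OF _ 3] ef[OF _ 3] between_sym[of x] by auto
  qed
qed

text \<open>At a vertex this is the connectedness of a punctured neighbourhood. At an edge, both ends
  are incident with both faces; at a face, vertices and sides alternate around the triangle.\<close>

lemma link_connected:
  assumes c: "c \<in> cells T"
    and A: "A \<subseteq> {x. incident T c x}" "A \<noteq> {}"
    and cl: "\<And>x y. x \<in> A \<Longrightarrow> y \<in> between c x \<Longrightarrow> y \<in> A"
  shows "A = {x. incident T c x}"
  using c
proof (cases rule: cells_cases)
  case (1 v)
  have ex: "between c x \<noteq> {}" if "incident T c x" for x using card_between[OF that] by auto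
  have bt: "y \<in> between c x" if "incident T c x" "y \<in> between c x" for x y using that by blast
  have F: "A \<inter> faces T = {f \<in> faces T. v \<in> closure f}"
  proof (rule vertex_faces_connected[OF 1(1)])
    show "A \<inter> faces T \<subseteq> {f \<in> faces T. v \<in> closure f}"
      using A(1) incident_vertex_face[OF 1(1)] 1(2) by blast
    obtain x where x: "x \<in> A" using A(2) by blast
    show "A \<inter> faces T \<noteq> {}"
    proof (cases "x \<in> faces T")
      case False
      then have e: "x \<in> edges T" "v \<in> closure x" using x A(1) vertex_link[OF 1(1), of x] 1(2) by blast+
      obtain f where "f \<in> between c x" using x A(1) ex by blast
      then show ?thesis using cl[OF x, of f] between_vertex_edge[OF 1(1) e] 1(2) by blast
    qed (use x in blast)
    show "g \<in> A \<inter> faces T" if e: "e \<in> edges T" "v \<in> closure e" and f: "f \<in> A \<inter> faces T" "g \<in> faces T"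
        "e \<subseteq> closure f" "e \<subseteq> closure g" for e f g
    proof -
      have "e \<in> between c f" using e f 1 incident_vertex_edge incident_edge_face incident_sym
        unfolding between_def by blast
      then have "e \<in> A" using cl f(1) by blast
      then show ?thesis using cl[of e g] between_vertex_edge[OF 1(1) e] 1(2) f by blast
    qed
  qed
  show ?thesis
  proof (intro equalityI A(1) subsetI)
    fix x assume x: "x \<in> {x. incident T c x}"
    show "x \<in> A"
    proof (cases "x \<in> faces T")
      case True
      then show ?thesis using F x vertex_link[OF 1(1), of x] 1(2) by blast
    next
      case False
      then have e: "x \<in> edges T" "v \<in> closure x" using x vertex_link[OF 1(1), of x] 1(2) by blast+
      obtain f where f: "f \<in> between c x" using x ex by blast
      then have "f \<in> A" using F vertex_link[OF 1(1), of f] between_vertex_edge[OF 1(1) e] 1(2)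
        unfolding between_def by blast
      then show ?thesis using cl[of f x] f x incident_sym unfolding between_def by blast
    qed
  qed
next
  case 2
  let ?V = "(\<lambda>v. {v}) ` (verts T \<inter> closure c)" and ?F = "{f \<in> faces T. c \<subseteq> closure f}"
  obtain a b where ab: "a \<noteq> b" "verts T \<inter> closure c = {a, b}" using edge_endpoints[OF 2] .
  have lk: "{x. incident T c x} = ?V \<union> ?F" using edge_link[OF 2] by blast
  have VF: "?F = between c x" if "x \<in> ?V" for x
    using that between_vertex_edge[OF _ 2] between_sym by blast
  have FV: "?V = between c x" if "x \<in> ?F" for x
    using that between_edge_face[OF 2] by blast
  have "?F \<noteq> {}" using edge_two_faces[OF 2] by (metis card.empty zero_neq_numeral)
  then obtain f where f: "f \<in> ?F" by blast
  have a: "{a} \<in> ?V" using ab by simp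
  have V: "?F \<subseteq> A" if "x \<in> ?V" "x \<in> A" for x unfolding VF[OF that(1)] using cl[OF that(2)] by blast
  have F: "?V \<subseteq> A" if "x \<in> ?F" "x \<in> A" for x unfolding FV[OF that(1)] using cl[OF that(2)] by blast
  obtain x where x: "x \<in> A" using A(2) by blast
  then have "x \<in> ?V \<or> x \<in> ?F" using A(1) unfolding lk by blast
  then have "?V \<subseteq> A \<and> ?F \<subseteq> A"
  proof
    assume "x \<in> ?V"
    then have "?F \<subseteq> A" using V x by blast
    then show ?thesis using F[OF f] f by blast
  next
    assume "x \<in> ?F"
    then have "?V \<subseteq> A" using F x by blast
    then show ?thesis using V[OF a] a by blast
  qed
  then show ?thesis using A(1) unfolding lk by (simp add: subset_antisym)
next
  case 3
  obtain u v w e1 e2 e3 where t: "distinct [u, v, w]" "verts T \<inter> closure c = {u, v, w}"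
    "distinct [e1, e2, e3]" "{e \<in> edges T. e \<subseteq> closure c} = {e1, e2, e3}"
    "verts T \<inter> closure e1 = {u, v}" "verts T \<inter> closure e2 = {v, w}" "verts T \<inter> closure e3 = {w, u}"
    using face_corners_and_sides[OF 3] .
  have lk: "{x. incident T c x} = {{u}, {v}, {w}, e1, e2, e3}"
  proof -
    have "{x. incident T c x} = (\<lambda>v. {v}) ` (verts T \<inter> closure c) \<union> {e \<in> edges T. e \<subseteq> closure c}"
      using face_link[OF 3] by blast
    also have "\<dots> = {{u}, {v}, {w}, e1, e2, e3}" unfolding t(2,4) by auto
    finally show ?thesis .
  qed
  have iff: "{p} \<in> A \<longleftrightarrow> e \<in> A" if "e \<in> {e1, e2, e3}" "p \<in> verts T \<inter> closure e" for p e
  proof -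
    have e: "e \<in> edges T" "e \<subseteq> closure c" using that(1) t(4) by blast+
    then have "closure e \<subseteq> closure c" by (simp add: closure_minimal)
    then have "{p} \<in> between c e" "e \<in> between c {p}"
      using e that(2) incident_vertex_edge[of p e] face_link[OF 3] incident_sym unfolding between_def by blast+
    then show ?thesis using cl by blast
  qed
  have "{u} \<in> A \<longleftrightarrow> e1 \<in> A" "{v} \<in> A \<longleftrightarrow> e1 \<in> A" "{v} \<in> A \<longleftrightarrow> e2 \<in> A"
    "{w} \<in> A \<longleftrightarrow> e2 \<in> A" "{w} \<in> A \<longleftrightarrow> e3 \<in> A" "{u} \<in> A \<longleftrightarrow> e3 \<in> A"
    by (rule iff; use t(5-7) in blast)+
  moreover obtain x where "x \<in> A" "x \<in> {{u}, {v}, {w}, e1, e2, e3}" using A unfolding lk by blast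
  ultimately have "{{u}, {v}, {w}, e1, e2, e3} \<subseteq> A" by auto
  then show ?thesis using A(1) unfolding lk by (rule subset_antisym[rotated])
qed

lemma link_nonempty:
  assumes "c \<in> cells T"
  shows "\<exists>x. incident T c x"
  using assms
proof (cases rule: cells_cases)
  case (1 v)
  then show ?thesis using faces_cover vertex_link[OF 1(1)] verts_sphere by blast
next
  case 2
  then show ?thesis using edge_link[OF 2] edge_endpoints[OF 2] by (metis IntE insertCI)
next
  case 3
  then show ?thesis using face_link[OF 3] face_corners_and_sides[OF 3] by (metis IntE insertCI)
qed

end

section \<open>Two-regular relations and cyclic lists\<close>

text \<open>Start a walk that never turns back. At the first repetition it must have returned to its
  start, because every other element already has its two neighbours on the walk. The closed walk
  then contains all neighbours of its elements, and connectedness shows that it visits everything.\<close>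

lemma two_regular_connected_cycle:
  fixes R :: "'a \<Rightarrow> 'a \<Rightarrow> bool"
  assumes X: "finite X" "X \<noteq> {}"
    and RX: "\<And>x y. R x y \<Longrightarrow> x \<in> X \<and> y \<in> X"
    and sym: "\<And>x y. R x y \<Longrightarrow> R y x" and irrefl: "\<And>x. \<not> R x x"
    and two: "\<And>x. x \<in> X \<Longrightarrow> card {y. R x y} = 2"
    and conn: "\<And>A. A \<subseteq> X \<Longrightarrow> A \<noteq> {} \<Longrightarrow> (\<And>x y. x \<in> A \<Longrightarrow> R x y \<Longrightarrow> y \<in> A) \<Longrightarrow> A = X"
  obtains xs where "distinct xs" "set xs = X" "length xs \<ge> 3"
    "\<And>i j. i < length xs \<Longrightarrow> j < length xs \<Longrightarrow> cyclically_consecutive (length xs) i j \<longleftrightarrow> R (xs ! i) (xs ! j)"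
proof -
  define nxt where "nxt = (\<lambda>x y. SOME z. R y z \<and> z \<noteq> x)"
  have nxt: "nxt x y \<noteq> x \<and> {z. R y z} = {x, nxt x y}" if "R x y" for x y
  proof -
    have yx: "R y x" using sym that by blast
    have "card {z. R y z} = 2" using two RX[OF yx] by blast
    then obtain p q where pq: "{z. R y z} = {p, q}" "p \<noteq> q" unfolding card_2_iff by blast
    have "p \<in> {z. R y z}" "q \<in> {z. R y z}" unfolding pq(1) by simp_all
    then have "\<exists>z. R y z \<and> z \<noteq> x" using pq(2) by (cases "p = x") auto
    then have z: "R y (nxt x y) \<and> nxt x y \<noteq> x" unfolding nxt_def by (rule someI_ex)
    have "x \<in> {z. R y z}" "nxt x y \<in> {z. R y z}" using z yx by auto
    then have "x = p \<or> x = q" "nxt x y = p \<or> nxt x y = q" unfolding pq(1) by simp_all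
    then have "{x, nxt x y} = {p, q}" using z by auto
    then show ?thesis using z pq(1) by simp
  qed
  obtain x0 where "x0 \<in> X" using X by blast
  then obtain x1 where x01: "R x0 x1" using two[of x0] by (metis card.empty empty_Collect_eq zero_neq_numeral)
  define p where "p = (\<lambda>n. ((\<lambda>(x, y). (y, nxt x y)) ^^ n) (x0, x1))"
  define s where "s = fst \<circ> p"
  have snd: "snd (p n) = s (Suc n)" for n by (simp add: p_def s_def split_beta)
  have ss: "s (Suc (Suc n)) = nxt (s n) (s (Suc n))" for n
    by (simp add: s_def p_def split_beta)
  have s0: "s 0 = x0" "s 1 = x1" by (simp_all add: s_def p_def)
  have R: "R (s n) (s (Suc n))" for n
  proof (induction n)
    case 0 then show ?case using x01 s0 by simp
  next
    case (Suc n) then show ?case using nxt[OF Suc] ss[of n] by auto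
  qed
  have nb: "{z. R (s (Suc n)) z} = {s n, s (Suc (Suc n))}" and ne: "s (Suc (Suc n)) \<noteq> s n" for n
    using nxt[OF R[of n]] ss by auto
  have sX: "range s \<subseteq> X" using R RX by blast
  have "\<not> inj s" using X(1) sX finite_subset finite_imageD infinite_UNIV_nat by metis
  then have "\<exists>n. \<exists>j<n. s n = s j" unfolding inj_def by (metis linorder_neqE_nat)
  then have ex: "\<exists>n. \<exists>j<n. s n = s j" .
  define n where "n = (LEAST n. \<exists>j<n. s n = s j)"
  have n: "\<exists>j<n. s n = s j" unfolding n_def by (rule LeastI_ex[OF ex])
  have least: "\<not> (\<exists>j<m. s m = s j)" if "m < n" for m
    using not_less_Least[OF that[unfolded n_def]] .
  have inj: "i = j" if "s i = s j" "i < n" "j < n" for i j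
    using least that by (metis linorder_neqE_nat)
  obtain j where j: "j < n" "s n = s j" using n by blast
  obtain n' where n': "n = Suc n'" using j by (cases n) auto
  \<comment> \<open>An earlier element other than the start has both neighbours on the walk already.\<close>
  have "j = 0"
  proof (rule ccontr)
    assume "j \<noteq> 0"
    then obtain j' where j': "j = Suc j'" by (cases j) auto
    have "R (s j) (s n')" using sym[OF R[of n']] j(2) n' by simp
    then have "s n' = s j' \<or> s n' = s (Suc j)" using nb[of j'] j' by blast
    moreover have "s n' \<noteq> s j'" using inj[of n' j'] j j' n' by auto
    ultimately have *: "s n' = s (Suc j)" by blast
    have "Suc j \<noteq> n" using R[of j] j(2) irrefl by metis
    then have "n' = Suc j" using inj[OF *] j(1) n' by auto
    then show False using ne[of j] j(2) n' by simp
  qed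
  then have sn: "s n = s 0" using j by simp
  have "n \<noteq> 1" using R[of 0] sn irrefl by auto
  moreover have "n \<noteq> 2" using ne[of 0] sn by (auto simp: numeral_2_eq_2)
  ultimately have n3: "n \<ge> 3" using j by linarith
  have nb0: "{z. R (s 0) z} = {s n', s 1}"
  proof -
    have "s n' \<noteq> s 1" using inj[of n' 1] n3 n' by auto
    moreover have "R (s 0) (s 1)" using R[of 0] by simp
    moreover have "R (s 0) (s n')" using sym[OF R[of n']] sn n' by simp
    ultimately have sub: "{s n', s 1} \<subseteq> {z. R (s 0) z}" "card {s n', s 1} = 2" by auto
    have "s 0 \<in> X" using sX by blast
    then have "card {z. R (s 0) z} = 2" using two by blast
    then show ?thesis using sub card_subset_eq[OF _ sub(1)] by (metis card.infinite zero_neq_numeral)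
  qed
  have img: "s ` {..<n} = X"
  proof (rule conn)
    show "s ` {..<n} \<subseteq> X" using sX by blast
    show "s ` {..<n} \<noteq> {}" using j(1) by blast
    fix x y assume "x \<in> s ` {..<n}" "R x y"
    then obtain i where i: "i < n" "x = s i" by auto
    show "y \<in> s ` {..<n}"
    proof (cases i)
      case 0
      then have "y = s n' \<or> y = s 1" using nb0 \<open>R x y\<close> i by blast
      then show ?thesis using n' n3 by auto
    next
      case (Suc k)
      then have "y = s k \<or> y = s (Suc i)" using nb[of k] \<open>R x y\<close> i by blast
      moreover have "s (Suc i) \<in> s ` {..<n}"
        using sn i(1) by (cases "Suc i = n") auto
      ultimately show ?thesis using i Suc by auto
    qed
  qed
  have iff: "cyclically_consecutive n i j \<longleftrightarrow> R (s i) (s j)" if ij: "i < n" "j < n" for i j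
  proof (cases i)
    case 0
    have "R (s i) (s j) \<longleftrightarrow> s j = s n' \<or> s j = s 1" using nb0 0 by blast
    also have "\<dots> \<longleftrightarrow> j = n' \<or> j = 1" using inj[of j n'] inj[of j 1] ij n3 n' by auto
    also have "\<dots> \<longleftrightarrow> cyclically_consecutive n i j"
      using 0 ij n3 n' unfolding cyclically_consecutive_def by (cases "j = n'") (auto)
    finally show ?thesis by simp
  next
    case (Suc k)
    have "R (s i) (s j) \<longleftrightarrow> s j = s k \<or> s j = s (Suc i)" using nb[of k] Suc by blast
    also have "\<dots> \<longleftrightarrow> j = k \<or> j = Suc i mod n"
    proof (cases "Suc i = n")
      case True
      then show ?thesis using inj[of j k] inj[of j 0] ij Suc sn by auto
    next
      case False
      then show ?thesis using inj[of j k] inj[of j "Suc i"] ij Suc by auto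
    qed
    also have "j = k \<longleftrightarrow> i = Suc j mod n"
      using ij Suc by (cases "Suc j = n") auto
    finally show ?thesis unfolding cyclically_consecutive_def by blast
  qed
  show ?thesis
  proof (rule that[of "map s [0..<n]"])
    show "distinct (map s [0..<n])" using inj by (auto simp: distinct_map inj_on_def)
    show "set (map s [0..<n]) = X" using img by (simp add: atLeast0LessThan)
    show "length (map s [0..<n]) \<ge> 3" using n3 by simp
    show "cyclically_consecutive (length (map s [0..<n])) i j \<longleftrightarrow> R (map s [0..<n] ! i) (map s [0..<n] ! j)"
      if "i < length (map s [0..<n])" "j < length (map s [0..<n])" for i j
      using iff that by simp
  qed
qed

text \<open>Positions are integers, so that rotations and reflections of a cyclic list are affine maps.\<close>

definition cyclic_nth :: "'a list \<Rightarrow> int \<Rightarrow> 'a" where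
  "cyclic_nth xs i = xs ! nat (i mod int (length xs))"

lemma cyclic_nth_in_set: "xs \<noteq> [] \<Longrightarrow> cyclic_nth xs i \<in> set xs"
  unfolding cyclic_nth_def by (intro nth_mem) (simp add: nat_less_iff)

lemma cyclic_nth_eq_iff:
  assumes "distinct xs" "xs \<noteq> []"
  shows "cyclic_nth xs i = cyclic_nth xs j \<longleftrightarrow> i mod int (length xs) = j mod int (length xs)"
proof -
  have "nat (k mod int (length xs)) < length xs" for k using assms(2) by (simp add: nat_less_iff)
  then show ?thesis unfolding cyclic_nth_def
    using nth_eq_iff_index_eq[OF assms(1)] assms(2) by (simp add: eq_nat_nat_iff)
qed

lemma cyclic_nth_of_nat: "i < length xs \<Longrightarrow> cyclic_nth xs (int i) = xs ! i"
  unfolding cyclic_nth_def by simp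

lemma in_set_imp_cyclic_nth:
  assumes "x \<in> set xs"
  obtains i where "0 \<le> i" "i < int (length xs)" "x = cyclic_nth xs i"
proof -
  obtain k where "k < length xs" "x = xs ! k" using assms by (auto simp: in_set_conv_nth)
  then show ?thesis using that[of "int k"] cyclic_nth_of_nat by force
qed

lemma cyclically_consecutive_mod:
  assumes "n > 0"
  shows "cyclically_consecutive n (nat (i mod int n)) (nat (j mod int n)) \<longleftrightarrow>
    j mod int n = (i + 1) mod int n \<or> j mod int n = (i - 1) mod int n"
proof -
  have suc: "int (Suc (nat (k mod int n)) mod n) = (k + 1) mod int n" for k
    using assms by (simp add: zmod_int mod_simps add.commute)
  have nat: "int (nat (k mod int n)) = k mod int n" for k using assms by simp
  have "nat (j mod int n) = Suc (nat (i mod int n)) mod n \<longleftrightarrow> j mod int n = (i + 1) mod int n" for i j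
    using suc[of i] nat[of j] by (metis of_nat_eq_iff)
  moreover have "i mod int n = (j + 1) mod int n \<longleftrightarrow> j mod int n = (i - 1) mod int n"
    by (auto simp: mod_eq_dvd_iff algebra_simps dvd_diff_commute)
  ultimately show ?thesis unfolding cyclically_consecutive_def by blast
qed

text \<open>A walk along the whole integer line that never turns back, in a relation in which every
  visited element has two neighbours: the covering map from the line onto a cycle.\<close>

definition line_covering :: "('a \<Rightarrow> 'a \<Rightarrow> bool) \<Rightarrow> (int \<Rightarrow> 'a) \<Rightarrow> bool" where
  "line_covering R a \<longleftrightarrow> (\<forall>i. a (i - 1) \<noteq> a (i + 1) \<and> {y. R (a i) y} = {a (i - 1), a (i + 1)})"

lemma line_coveringD:
  assumes "line_covering R a"
  shows "a (i - 1) \<noteq> a (i + 1)" "{y. R (a i) y} = {a (i - 1), a (i + 1)}"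
  using assms unfolding line_covering_def by auto

lemma line_covering_reflect:
  assumes "line_covering R a"
  shows "line_covering R (\<lambda>i. a (c - i))"
  using line_coveringD[OF assms, of "c - i" for i] line_coveringD(1)[OF assms, THEN not_sym, of "c - i" for i]
  unfolding line_covering_def
  by (auto simp: algebra_simps insert_commute)

lemma line_covering_shift:
  assumes "line_covering R a"
  shows "line_covering R (\<lambda>i. a (c + i))"
  using line_coveringD[OF assms, of "c + i" for i] unfolding line_covering_def
  by (auto simp: algebra_simps)

text \<open>A covering is determined by two consecutive values, since from then on the next element is
  always the neighbour that was not visited just before.\<close>

lemma line_coverings_equal:
  assumes a: "line_covering R a" and b: "line_covering R b" and "a 0 = b 0" "a 1 = b 1"
  shows "a = b"
proof -
  have up: "a (i + 2) = b (i + 2)" if "a i = b i" "a (i + 1) = b (i + 1)" for i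
    using line_coveringD[OF a, of "i + 1"] line_coveringD[OF b, of "i + 1"] that
    by (auto simp: doubleton_eq_iff algebra_simps)
  have down: "a (i - 1) = b (i - 1)" if "a i = b i" "a (i + 1) = b (i + 1)" for i
    using line_coveringD[OF a, of "i"] line_coveringD[OF b, of "i"] that
    by (auto simp: doubleton_eq_iff algebra_simps)
  have "a i = b i \<and> a (i + 1) = b (i + 1)" for i
  proof (induction i rule: int_induct[where k = 0])
    case base then show ?case using assms(3,4) by simp
  next
    case (step1 i) then show ?case using up[of i] by (simp add: algebra_simps)
  next
    case (step2 i) then show ?case using down[of i] by simp
  qed
  then show ?thesis by blast
qed

lemma line_coverings_agree:
  assumes a: "line_covering R a" and b: "line_covering R b" and "b 0 \<in> range a"
  obtains c where "\<And>i. b i = a (c + i)" | c where "\<And>i. b i = a (c - i)"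
proof -
  obtain c where c: "b 0 = a c" using assms(3) by blast
  have "b 1 \<in> {y. R (b 0) y}" using line_coveringD(2)[OF b, of 0] by simp
  then have "b 1 = a (c + 1) \<or> b 1 = a (c - 1)" using line_coveringD(2)[OF a, of c] c by auto
  then show ?thesis
  proof
    assume "b 1 = a (c + 1)"
    then have "b = (\<lambda>i. a (c + i))" using c by (intro line_coverings_equal[OF b line_covering_shift[OF a]]) auto
    then show ?thesis using that(1) by blast
  next
    assume "b 1 = a (c - 1)"
    then have "b = (\<lambda>i. a (c - i))" using c by (intro line_coverings_equal[OF b line_covering_reflect[OF a]]) auto
    then show ?thesis using that(2) by blast
  qed
qed

lemma line_covering_cyclic_nth:
  assumes xs: "distinct xs" "length xs \<ge> 3"
    and R: "\<And>x y. R x y \<Longrightarrow> x \<in> set xs \<and> y \<in> set xs"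
    and iff: "\<And>i j. i < length xs \<Longrightarrow> j < length xs \<Longrightarrow> cyclically_consecutive (length xs) i j \<longleftrightarrow> R (xs ! i) (xs ! j)"
  shows "line_covering R (cyclic_nth xs)"
  unfolding line_covering_def
proof (intro allI conjI)
  fix i :: int
  let ?n = "int (length xs)"
  have ne: "xs \<noteq> []" using xs(2) by auto
  show "cyclic_nth xs (i - 1) \<noteq> cyclic_nth xs (i + 1)"
  proof
    assume "cyclic_nth xs (i - 1) = cyclic_nth xs (i + 1)"
    then have "?n dvd (i - 1) - (i + 1)" unfolding cyclic_nth_eq_iff[OF xs(1) ne] mod_eq_dvd_iff .
    then have "?n dvd 2" by (metis add_diff_cancel_left diff_diff_eq2 diff_minus_eq_add dvd_minus_iff minus_diff_eq one_add_one diff_add_eq)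
    then show False using xs(2) zdvd_imp_le by fastforce
  qed
  have RI: "R (cyclic_nth xs i) (cyclic_nth xs j) \<longleftrightarrow> cyclic_nth xs j = cyclic_nth xs (i + 1) \<or> cyclic_nth xs j = cyclic_nth xs (i - 1)" for j
    unfolding cyclic_nth_eq_iff[OF xs(1) ne]
    using cyclically_consecutive_mod[of "length xs" i j] iff[of "nat (i mod ?n)" "nat (j mod ?n)"] ne
    by (simp add: cyclic_nth_def nat_less_iff)
  show "{y. R (cyclic_nth xs i) y} = {cyclic_nth xs (i - 1), cyclic_nth xs (i + 1)}"
  proof (intro equalityI subsetI)
    fix y assume y: "y \<in> {y. R (cyclic_nth xs i) y}"
    then obtain j where "y = cyclic_nth xs j" using R in_set_imp_cyclic_nth by (metis mem_Collect_eq)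
    then show "y \<in> {cyclic_nth xs (i - 1), cyclic_nth xs (i + 1)}" using y RI by blast
  next
    fix y assume "y \<in> {cyclic_nth xs (i - 1), cyclic_nth xs (i + 1)}"
    then show "y \<in> {y. R (cyclic_nth xs i) y}" using RI by blast
  qed
qed

text \<open>The constant \<open>- 1\<close> stems from \<^const>\<open>rev\<close>, which puts the last entry at position 0.\<close>

lemma map_eq_rotate_rev_iff:
  assumes "xs \<noteq> []"
  shows "map f xs = rotate k (rev xs) \<longleftrightarrow> (\<forall>i. f (cyclic_nth xs i) = cyclic_nth xs (- 1 - int k - i))"
proof -
  let ?n = "length xs"
  have n: "?n > 0" using assms by simp
  have r: "rotate k (rev xs) ! i = cyclic_nth xs (- 1 - int k - int i)" if "i < ?n" for i
  proof -
    let ?m = "(k + i) mod ?n"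
    have m: "?m < ?n" using n by simp
    have "rotate k (rev xs) ! i = xs ! (?n - Suc ?m)"
      using that m by (simp add: nth_rotate rev_nth)
    also have "int (?n - Suc ?m) = (int ?n - 1 - int ?m) mod int ?n"
      using m by (simp add: of_nat_diff)
    then have "?n - Suc ?m = nat ((int ?n - 1 - int ?m) mod int ?n)" by linarith
    also have "(int ?n - 1 - int ?m) mod int ?n = (- 1 - int k - int i) mod int ?n"
      by (simp add: zmod_int mod_simps algebra_simps)
    finally show ?thesis unfolding cyclic_nth_def .
  qed
  have "map f xs = rotate k (rev xs) \<longleftrightarrow> (\<forall>i<?n. f (xs ! i) = cyclic_nth xs (- 1 - int k - int i))"
    using r by (auto simp: list_eq_iff_nth_eq)
  also have "\<dots> \<longleftrightarrow> (\<forall>i. f (cyclic_nth xs i) = cyclic_nth xs (- 1 - int k - i))"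
  proof
    assume L: "\<forall>i<?n. f (xs ! i) = cyclic_nth xs (- 1 - int k - int i)"
    show "\<forall>i. f (cyclic_nth xs i) = cyclic_nth xs (- 1 - int k - i)"
    proof
      fix i
      let ?j = "nat (i mod int ?n)"
      have j: "?j < ?n" "int ?j = i mod int ?n" using n by (auto simp: nat_less_iff)
      have "f (cyclic_nth xs i) = cyclic_nth xs (- 1 - int k - int ?j)"
        using L j(1) unfolding cyclic_nth_def[of xs i] by blast
      also have "\<dots> = cyclic_nth xs (- 1 - int k - i)"
        unfolding cyclic_nth_def j(2) by (simp add: mod_simps)
      finally show "f (cyclic_nth xs i) = cyclic_nth xs (- 1 - int k - i)" .
    qed
  next
    assume "\<forall>i. f (cyclic_nth xs i) = cyclic_nth xs (- 1 - int k - i)"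
    then show "\<forall>i<?n. f (xs ! i) = cyclic_nth xs (- 1 - int k - int i)"
      by (metis cyclic_nth_of_nat)
  qed
  finally show ?thesis .
qed

section \<open>Subgroups of dihedral groups\<close>

lemma int_subgroup_generator:
  fixes S :: "int set"
  assumes zero: "0 \<in> S" and add: "\<And>a b. a \<in> S \<Longrightarrow> b \<in> S \<Longrightarrow> a + b \<in> S"
    and neg: "\<And>a. a \<in> S \<Longrightarrow> - a \<in> S" and pos: "d \<in> S" "d > 0"
  obtains g where "g > 0" "g dvd d" "\<And>a. a \<in> S \<longleftrightarrow> g dvd a"
proof -
  have nmult: "a * int k \<in> S" if "a \<in> S" for a k
    by (induction k) (use that zero add in \<open>auto simp: algebra_simps\<close>)
  have mult: "a * k \<in> S" if "a \<in> S" for a k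
  proof (cases "k \<ge> 0")
    case True
    then show ?thesis using nmult[OF that, of "nat k"] by simp
  next
    case False
    then show ?thesis using neg[OF nmult[OF that, of "nat (- k)"]] by simp
  qed
  define m where "m = (LEAST m. m > 0 \<and> int m \<in> S)"
  have ex: "\<exists>m. m > 0 \<and> int m \<in> S" using pos by (intro exI[of _ "nat d"]) auto
  have m: "m > 0" "int m \<in> S" using LeastI_ex[OF ex] unfolding m_def by auto
  have least: "\<not> (k > 0 \<and> int k \<in> S)" if "k < m" for k
    using not_less_Least[OF that[unfolded m_def]] .
  have iff: "a \<in> S \<longleftrightarrow> int m dvd a" for a
  proof
    assume a: "a \<in> S"
    have "a mod int m = a + int m * (- (a div int m))" by (simp add: minus_mult_div_eq_mod [symmetric])
    moreover have "a + int m * (- (a div int m)) \<in> S" using add[OF a mult[OF m(2)]] .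
    ultimately have "a mod int m \<in> S" by (simp only:)
    moreover have "0 \<le> a mod int m" "a mod int m < int m" using m(1) by simp_all
    ultimately have "a mod int m = 0" using least[of "nat (a mod int m)"] by (auto simp: nat_less_iff)
    then show "int m dvd a" by (simp add: dvd_eq_mod_eq_0)
  next
    assume "int m dvd a"
    then show "a \<in> S" using mult[OF m(2)] by (auto elim!: dvdE)
  qed
  show ?thesis using that[of "int m"] m iff pos(1) by simp
qed

lemma mult_dihedral_group:
  "(a, s) \<otimes>\<^bsub>dihedral_group n\<^esub> (b, t) = ((if s then a - b else a + b) mod int n, s \<noteq> t)"
  by (simp add: dihedral_group_def)

lemma carrier_dihedral_group: "carrier (dihedral_group n) = {0..<int n} \<times> UNIV"
  by (simp add: dihedral_group_def)

lemma dihedral_group_1_iso: "dihedral_group 1 \<cong> integer_mod_group 2"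
proof (rule is_isoI)
  let ?h = "\<lambda>(a::int, s). if s then 1 else 0 :: int"
  have "?h \<in> hom (dihedral_group 1) (integer_mod_group 2)"
    by (rule homI) (auto simp: carrier_dihedral_group mult_dihedral_group carrier_integer_mod_group)
  moreover have "bij_betw ?h (carrier (dihedral_group 1)) (carrier (integer_mod_group 2))"
  proof (rule bij_betw_byWitness[where f' = "\<lambda>x. (0, x = 1)"])
    show "?h ` carrier (dihedral_group 1) \<subseteq> carrier (integer_mod_group 2)"
      by (auto simp: carrier_dihedral_group carrier_integer_mod_group)
  qed (auto simp: carrier_dihedral_group carrier_integer_mod_group)
  ultimately show "?h \<in> iso (dihedral_group 1) (integer_mod_group 2)"
    unfolding iso_def by blast
qed

text \<open>The integers that represent rotations in \<open>K\<close> form a subgroup, generated by a divisor \<open>g\<close> of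
  \<open>d\<close>, so the number of rotations is \<open>n = d div g\<close>. If \<open>K\<close> contains a reflection \<open>(r, True)\<close>, its
  reflections are exactly the \<open>(a, True)\<close> with \<open>a\<close> congruent to \<open>r\<close> modulo \<open>g\<close>, and stretching by
  \<open>g\<close> and shifting by \<open>r\<close> identifies \<open>dihedral_group n\<close> with \<open>K\<close>.\<close>

lemma dihedral_group_submonoid:
  assumes d: "d > 0" and K: "K \<subseteq> carrier (dihedral_group d)" "(0, False) \<in> K"
    and mult: "\<And>x y. x \<in> K \<Longrightarrow> y \<in> K \<Longrightarrow> x \<otimes>\<^bsub>dihedral_group d\<^esub> y \<in> K"
  obtains n where "n > 0" "n dvd d" "card {x \<in> K. \<not> snd x} = n"
    "(\<forall>x\<in>K. \<not> snd x) \<longrightarrow> (dihedral_group d)\<lparr>carrier := K\<rparr> \<cong> integer_mod_group n"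
    "(\<exists>x\<in>K. snd x) \<longrightarrow> (dihedral_group d)\<lparr>carrier := K\<rparr> \<cong> dihedral_group n"
proof -
  let ?S = "{a. (a mod int d, False) \<in> K}"
  have add: "a + b \<in> ?S" if "a \<in> ?S" "b \<in> ?S" for a b
    using mult[of "(a mod int d, False)" "(b mod int d, False)"] that
    by (simp add: mult_dihedral_group mod_simps)
  have nmult: "a * int k \<in> ?S" if "a \<in> ?S" for a k
  proof (induction k)
    case (Suc k) then show ?case using add[OF that Suc] by (simp add: algebra_simps)
  qed (use K in simp)
  have neg: "- a \<in> ?S" if "a \<in> ?S" for a
  proof -
    \<comment> \<open>The inverse of a rotation is its power with exponent \<open>d - 1\<close>.\<close>
    have "(a * int (d - 1)) mod int d = (a * int d + (- a)) mod int d"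
      using d by (simp add: of_nat_diff algebra_simps)
    also have "\<dots> = (- a) mod int d" by (rule mod_mult_self3)
    finally show ?thesis using nmult[OF that, of "d - 1"] by simp
  qed
  obtain g where g: "g > 0" "g dvd int d" and gS: "\<And>a. a \<in> ?S \<longleftrightarrow> g dvd a"
    using int_subgroup_generator[of ?S "int d", OF _ add neg] K(2) d by auto
  define n where "n = nat (int d div g)"
  have dn: "int d = g * int n" using g d unfolding n_def by (simp add: pos_imp_zdiv_nonneg_iff)
  have n: "n > 0" using dn d by (intro gr0I) simp
  have "n dvd d" using dn by (metis dvd_triv_right int_dvd_int_iff)
  have Krot: "(a, False) \<in> K \<longleftrightarrow> 0 \<le> a \<and> a < int d \<and> g dvd a" for a
  proof -
    have "0 \<le> a \<and> a < int d" if "(a, False) \<in> K" using that K(1) by (auto simp: carrier_dihedral_group)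
    moreover have "(a, False) \<in> K \<longleftrightarrow> g dvd a" if "0 \<le> a \<and> a < int d" using gS[of a] that by simp
    ultimately show ?thesis by blast
  qed
  have gmod: "g * (a mod int n) = (g * a) mod int d" for a
    unfolding dn by (rule mult_mod_right)
  have range: "0 \<le> g * j \<and> g * j < int d \<longleftrightarrow> 0 \<le> j \<and> j < int n" for j
    using g(1) by (simp add: dn zero_le_mult_iff)
  let ?rot = "\<lambda>j. (g * j, False)"
  have rot: "bij_betw ?rot {0..<int n} {x \<in> K. \<not> snd x}"
    unfolding bij_betw_def
  proof
    show "inj_on ?rot {0..<int n}" using g(1) by (auto simp: inj_on_def)
    show "?rot ` {0..<int n} = {x \<in> K. \<not> snd x}"
    proof (intro equalityI subsetI)
      fix x assume "x \<in> ?rot ` {0..<int n}"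
      then obtain j where j: "x = (g * j, False)" "j \<in> {0..<int n}" by blast
      then have "(g * j, False) \<in> K" using Krot[of "g * j"] range[of j] by simp
      then show "x \<in> {x \<in> K. \<not> snd x}" using j(1) by simp
    next
      fix x assume "x \<in> {x \<in> K. \<not> snd x}"
      then obtain a where a: "x = (a, False)" "(a, False) \<in> K" by (cases x) auto
      then have "g dvd a" "0 \<le> a \<and> a < int d" using Krot[of a] by simp_all
      then obtain j where j: "a = g * j" by (elim dvdE)
      then have "0 \<le> j \<and> j < int n" using \<open>0 \<le> a \<and> a < int d\<close> range[of j] by simp
      then show "x \<in> ?rot ` {0..<int n}" using a(1) j by (intro image_eqI[of _ _ j]) auto
    qed
  qed
  have card: "card {x \<in> K. \<not> snd x} = n" using bij_betw_same_card[OF rot] by simp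
  have cyc: "(dihedral_group d)\<lparr>carrier := K\<rparr> \<cong> integer_mod_group n" if no: "\<forall>x\<in>K. \<not> snd x"
  proof -
    have KK: "{x \<in> K. \<not> snd x} = K" using no by blast
    have "?rot \<in> hom (integer_mod_group n) ((dihedral_group d)\<lparr>carrier := K\<rparr>)"
      using rot n unfolding KK
      by (intro homI) (auto simp: carrier_integer_mod_group mult_dihedral_group gmod algebra_simps bij_betw_def)
    then have "?rot \<in> iso (integer_mod_group n) ((dihedral_group d)\<lparr>carrier := K\<rparr>)"
      using rot n unfolding KK iso_def by (simp add: carrier_integer_mod_group)
    then show ?thesis using group.iso_sym[OF group_integer_mod_group] is_isoI by blast
  qed
  have dih: "(dihedral_group d)\<lparr>carrier := K\<rparr> \<cong> dihedral_group n" if ex: "\<exists>x\<in>K. snd x"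
  proof -
    obtain r where r: "(r, True) \<in> K" using ex by (metis prod.collapse)
    have Kref: "(a mod int d, True) \<in> K \<longleftrightarrow> g dvd a - r" for a
    proof
      assume "(a mod int d, True) \<in> K"
      then have "a - r \<in> ?S" using mult[OF _ r, of "(a mod int d, True)"] by (simp add: mult_dihedral_group mod_simps)
      then show "g dvd a - r" using gS by simp
    next
      assume "g dvd a - r"
      then have "((a - r) mod int d, False) \<in> K" using gS[of "a - r"] by simp
      then show "(a mod int d, True) \<in> K" using mult[OF _ r] by (force simp: mult_dihedral_group mod_simps)
    qed
    let ?h = "\<lambda>(j, s). ((g * j + (if s then r else 0)) mod int d, s)"
    have hK: "?h x \<in> K" for x
      using gS[of "g * fst x"] Kref[of "g * fst x + r"] by (cases x) auto
    have hom: "?h \<in> hom (dihedral_group n) ((dihedral_group d)\<lparr>carrier := K\<rparr>)"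
    proof (rule homI)
      fix x y :: "int \<times> bool"
      obtain j s i t where xy: "x = (j, s)" "y = (i, t)" by (metis surj_pair)
      show "?h (x \<otimes>\<^bsub>dihedral_group n\<^esub> y) = ?h x \<otimes>\<^bsub>(dihedral_group d)\<lparr>carrier := K\<rparr>\<^esub> ?h y"
        unfolding xy by (cases s; cases t; simp add: mult_dihedral_group gmod mod_simps ring_distribs; (simp add: algebra_simps)?)
    qed (use hK in simp)
    have inj: "inj_on ?h (carrier (dihedral_group n))"
    proof (rule inj_onI)
      fix x y assume x: "x \<in> carrier (dihedral_group n)" and y: "y \<in> carrier (dihedral_group n)" and eq: "?h x = ?h y"
      obtain j s i t where xy: "x = (j, s)" "y = (i, t)" by (metis surj_pair)
      have st: "s = t" and "(g * j + (if s then r else 0)) mod int d = (g * i + (if s then r else 0)) mod int d"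
        using eq xy by auto
      then have "int d dvd g * j - g * i" by (simp add: mod_eq_dvd_iff)
      then have "(g * j) mod int d = (g * i) mod int d" by (simp add: mod_eq_dvd_iff)
      then have "j mod int n = i mod int n" using g(1) by (simp flip: gmod)
      then show "x = y" using x y xy st by (simp add: carrier_dihedral_group)
    qed
    have surj: "K \<subseteq> ?h ` carrier (dihedral_group n)"
    proof
      fix x assume x: "x \<in> K"
      obtain a s where as: "x = (a, s)" by fastforce
      then have a: "0 \<le> a" "a < int d" using x K(1) by (auto simp: carrier_dihedral_group)
      have "g dvd a - (if s then r else 0)"
        using Kref[of a] Krot[of a] x as a by (cases s) auto
      then obtain j where j: "a - (if s then r else 0) = g * j" by (elim dvdE)
      have "x = ?h (j mod int n, s)"
        using a as j by (auto simp: gmod mod_simps split: if_splits)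
      then show "x \<in> ?h ` carrier (dihedral_group n)"
        using n by (intro image_eqI[of _ _ "(j mod int n, s)"]) (auto simp: carrier_dihedral_group)
    qed
    have "?h ` carrier (dihedral_group n) = K" using hK surj by blast
    then have "?h \<in> iso (dihedral_group n) ((dihedral_group d)\<lparr>carrier := K\<rparr>)"
      using hom inj unfolding iso_def bij_betw_def by simp
    then show ?thesis using group.iso_sym[OF group_dihedral_group[OF n]] is_isoI by blast
  qed
  show ?thesis using that[OF n \<open>n dvd d\<close> card] cyc dih by blast
qed

section \<open>The action of automorphisms on a link\<close>

lemma carrier_Aut: "carrier (Aut c T) = {\<phi> \<in> cell_automorphisms T. \<phi> c = c}"
  and one_Aut: "\<one>\<^bsub>Aut c T\<^esub> = (\<lambda>x\<in>cells T. x)"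
  by (simp_all add: Aut_def BijGroup_def)

lemma automorphismD:
  assumes "\<phi> \<in> cell_automorphisms T"
  shows "\<phi> \<in> Bij (cells T)" "\<phi> \<in> extensional (cells T)" "bij_betw \<phi> (cells T) (cells T)"
    "x \<in> cells T \<Longrightarrow> cell_dim T (\<phi> x) = cell_dim T x"
    "x \<in> cells T \<Longrightarrow> y \<in> cells T \<Longrightarrow> incident T (\<phi> x) (\<phi> y) \<longleftrightarrow> incident T x y"
  using assms unfolding cell_automorphisms_def Bij_def by auto

lemma mult_Aut:
  assumes "\<phi> \<in> cell_automorphisms T" "\<psi> \<in> cell_automorphisms T" "x \<in> cells T"
  shows "(\<phi> \<otimes>\<^bsub>Aut c T\<^esub> \<psi>) x = \<phi> (\<psi> x)"
  using automorphismD(1)[OF assms(1)] automorphismD(1)[OF assms(2)] assms(3)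
  by (simp add: Aut_def BijGroup_def compose_eq)

text \<open>A generating rotation moves every position of the cycle by two places: it preserves
  dimensions, and these alternate around the cycle.\<close>

definition dihedral_action :: "int \<times> bool \<Rightarrow> int \<Rightarrow> int" where
  "dihedral_action p i = 2 * fst p + (if snd p then - i else i)"

lemma dihedral_action_mult:
  "dihedral_action (p \<otimes>\<^bsub>dihedral_group d\<^esub> q) i mod (2 * int d) = dihedral_action p (dihedral_action q i) mod (2 * int d)"
proof -
  obtain a s b t where pq: "p = (a, s)" "q = (b, t)" by (metis surj_pair)
  have *: "(2 * (k mod int d) + l) mod (2 * int d) = (2 * k + l) mod (2 * int d)" for k l
    unfolding mult_mod_right by (rule mod_add_left_eq)
  show ?thesis
    unfolding pq dihedral_action_def mult_dihedral_group fst_conv snd_conv *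
    by (rule arg_cong[where f = "\<lambda>k. k mod (2 * int d)"]) (cases s; cases t; simp)
qed

lemma dihedral_action_faithful:
  assumes "p \<in> carrier (dihedral_group d)" "q \<in> carrier (dihedral_group d)" "d \<ge> 2"
    and eq: "\<And>i. dihedral_action p i mod (2 * int d) = dihedral_action q i mod (2 * int d)"
  shows "p = q"
proof -
  obtain a s b t where pq: "p = (a, s)" "q = (b, t)" by (metis surj_pair)
  have dvd: "2 * int d dvd dihedral_action p i - dihedral_action q i" for i
    using eq[of i] by (simp add: mod_eq_dvd_iff)
  have "2 * int d dvd 2 * (a - b)" using dvd[of 0] by (cases s; cases t; simp add: pq dihedral_action_def algebra_simps)
  then have "int d dvd a - b" unfolding dvd_mult_cancel_left by simp
  then have "a mod int d = b mod int d" by (simp add: mod_eq_dvd_iff)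
  then have ab: "a = b" using assms(1,2) by (simp add: pq carrier_dihedral_group)
  have "s = t"
  proof (rule ccontr)
    assume "s \<noteq> t"
    then have "2 * int d dvd 2 \<or> 2 * int d dvd - 2"
      using dvd[of 1] by (cases s; cases t) (auto simp: pq dihedral_action_def ab)
    then have "2 * int d dvd 2" by simp
    then show False using assms(3) zdvd_imp_le[of "2 * int d" 2] by simp
  qed
  then show ?thesis using pq ab by simp
qed

context triangulated_sphere
begin

lemma finite_cells: "finite (cells T)"
  unfolding cells_def vertex_cells_def using finite_verts finite_edges finite_faces by simp

definition link_adjacent :: "(real^3) set \<Rightarrow> (real^3) set \<Rightarrow> (real^3) set \<Rightarrow> bool" where
  "link_adjacent c x y \<longleftrightarrow> incident T c x \<and> incident T c y \<and> incident T x y"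

lemma link_adjacent_between: "incident T c x \<Longrightarrow> {y. link_adjacent c x y} = between c x"
  unfolding link_adjacent_def between_def by blast

lemma link_cyclic_order:
  assumes c: "c \<in> cells T"
  obtains xs where "cyclic_order_at T c xs" "length xs \<ge> 3"
proof -
  let ?X = "{x. incident T c x}"
  have "finite ?X" using finite_cells incident_cells by (metis (no_types, lifting) finite_subset mem_Collect_eq subsetI)
  moreover have "?X \<noteq> {}" using link_nonempty[OF c] by blast
  moreover have "x \<in> ?X \<and> y \<in> ?X" if "link_adjacent c x y" for x y using that unfolding link_adjacent_def by blast
  moreover have "link_adjacent c y x" if "link_adjacent c x y" for x y
    using that incident_sym unfolding link_adjacent_def by blast
  moreover have "\<not> link_adjacent c x x" for x using not_incident_same_dim[of x x] unfolding link_adjacent_def by blast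
  moreover have "card {y. link_adjacent c x y} = 2" if "x \<in> ?X" for x
    using card_between[of c x] link_adjacent_between[of c x] that by simp
  moreover have "A = ?X" if "A \<subseteq> ?X" "A \<noteq> {}" "\<And>x y. x \<in> A \<Longrightarrow> link_adjacent c x y \<Longrightarrow> y \<in> A" for A
  proof (rule link_connected[OF c that(1,2)])
    fix x y assume x: "x \<in> A" and "y \<in> between c x"
    then have "link_adjacent c x y" using that(1) link_adjacent_between[of c x] by blast
    then show "y \<in> A" using that(3) x by blast
  qed
  ultimately obtain xs where xs: "distinct xs" "set xs = ?X" "length xs \<ge> 3"
    "\<And>i j. i < length xs \<Longrightarrow> j < length xs \<Longrightarrow> cyclically_consecutive (length xs) i j \<longleftrightarrow> link_adjacent c (xs ! i) (xs ! j)"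
    using two_regular_connected_cycle[of ?X "link_adjacent c"] by blast
  have "link_adjacent c (xs ! i) (xs ! j) \<longleftrightarrow> incident T (xs ! i) (xs ! j)" if "i < length xs" "j < length xs" for i j
    using nth_mem[OF that(1)] nth_mem[OF that(2)] xs(2) unfolding link_adjacent_def by blast
  then show ?thesis using that[of xs] xs unfolding cyclic_order_at_def by simp
qed

lemma cyclic_order_line_covering:
  assumes c: "c \<in> cells T" and xs: "cyclic_order_at T c xs"
  shows "distinct xs" "set xs = {x. incident T c x}" "length xs \<ge> 3" "line_covering (link_adjacent c) (cyclic_nth xs)"
    "range (cyclic_nth xs) = {x. incident T c x}"
proof -
  show d: "distinct xs" and s: "set xs = {x. incident T c x}" using xs unfolding cyclic_order_at_def by auto
  obtain ys where ys: "cyclic_order_at T c ys" "length ys \<ge> 3" using link_cyclic_order[OF c] .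
  then have "distinct ys" "set ys = {x. incident T c x}" unfolding cyclic_order_at_def by auto
  then show l: "length xs \<ge> 3" using ys(2) d s by (metis distinct_card)
  have in_link: "incident T c (xs ! i)" if "i < length xs" for i using nth_mem[OF that] s by blast
  show "line_covering (link_adjacent c) (cyclic_nth xs)"
  proof (rule line_covering_cyclic_nth[OF d l])
    show "cyclically_consecutive (length xs) i j \<longleftrightarrow> link_adjacent c (xs ! i) (xs ! j)"
      if "i < length xs" "j < length xs" for i j
      using xs that in_link unfolding cyclic_order_at_def link_adjacent_def by simp
  qed (use s in \<open>auto simp: link_adjacent_def\<close>)
  have "xs \<noteq> []" using l by auto
  then show "range (cyclic_nth xs) = {x. incident T c x}"
    using cyclic_nth_in_set[of xs] in_set_imp_cyclic_nth[of _ xs] s by blast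
qed

lemma automorphism_link:
  assumes "\<phi> \<in> cell_automorphisms T" "c \<in> cells T" "\<phi> c = c" "x \<in> cells T"
  shows "incident T c (\<phi> x) \<longleftrightarrow> incident T c x"
  using automorphismD(5)[OF assms(1,2,4)] assms(3) by simp

text \<open>An automorphism fixing \<open>c\<close> permutes the link of \<open>c\<close> and preserves adjacency in it.\<close>

lemma automorphism_line_covering:
  assumes \<phi>: "\<phi> \<in> cell_automorphisms T" and c: "c \<in> cells T" "\<phi> c = c"
    and a: "line_covering (link_adjacent c) a" and ran: "range a = {x. incident T c x}"
  shows "line_covering (link_adjacent c) (\<lambda>i. \<phi> (a i))"
  unfolding line_covering_def
proof (intro allI conjI)
  fix i
  have ac: "a j \<in> cells T" for j using ran incident_cells by blast
  have bij: "bij_betw \<phi> (cells T) (cells T)" by (rule automorphismD(3)[OF \<phi>])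
  show "\<phi> (a (i - 1)) \<noteq> \<phi> (a (i + 1))"
    using line_coveringD(1)[OF a] ac bij by (metis bij_betw_def inj_onD)
  have iff: "link_adjacent c (\<phi> x) (\<phi> y) \<longleftrightarrow> link_adjacent c x y" if "x \<in> cells T" "y \<in> cells T" for x y
    unfolding link_adjacent_def using automorphism_link[OF \<phi> c] automorphismD(5)[OF \<phi>] that by simp
  have "{y. link_adjacent c (\<phi> (a i)) y} = \<phi> ` {y. link_adjacent c (a i) y}"
  proof (intro equalityI subsetI)
    fix y assume y: "y \<in> {y. link_adjacent c (\<phi> (a i)) y}"
    then have "y \<in> cells T" using incident_cells unfolding link_adjacent_def by blast
    then obtain y' where y': "y' \<in> cells T" "y = \<phi> y'" using bij by (metis bij_betw_imp_surj_on imageE)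
    then show "y \<in> \<phi> ` {y. link_adjacent c (a i) y}" using y iff[OF ac y'(1)] by blast
  next
    fix y assume "y \<in> \<phi> ` {y. link_adjacent c (a i) y}"
    then obtain y' where y': "link_adjacent c (a i) y'" "y = \<phi> y'" by blast
    moreover have "y' \<in> cells T" using y'(1) incident_cells unfolding link_adjacent_def by blast
    ultimately show "y \<in> {y. link_adjacent c (\<phi> (a i)) y}" using iff[OF ac] by blast
  qed
  then show "{y. link_adjacent c (\<phi> (a i)) y} = {\<phi> (a (i - 1)), \<phi> (a (i + 1))}"
    unfolding line_coveringD(2)[OF a] by simp
qed

text \<open>If \<open>x\<close> and one of its two neighbours in the link are fixed, then so is its other neighbour.
  Going around the link in this way reaches every cell of it.\<close>

lemma link_fixed_by_flag:
  assumes \<phi>: "\<phi> \<in> cell_automorphisms T" and c: "c \<in> cells T" "\<phi> c = c"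
    and xy: "incident T c x" "y \<in> between c x" "\<phi> x = x" "\<phi> y = y" and z: "incident T c z"
  shows "\<phi> z = z"
proof -
  let ?A = "{x. incident T c x \<and> \<phi> x = x \<and> (\<exists>y\<in>between c x. \<phi> y = y)}"
  have inj: "inj_on \<phi> (cells T)" using automorphismD(3)[OF \<phi>] by (simp add: bij_betw_def)
  have "?A = {x. incident T c x}"
  proof (rule link_connected[OF c(1)])
    show "?A \<noteq> {}" using xy by blast
    fix x z assume x: "x \<in> ?A" and z: "z \<in> between c x"
    then obtain y where y: "y \<in> between c x" "\<phi> y = y" by blast
    have cl: "x \<in> cells T" "z \<in> cells T" "y \<in> cells T" using x z y incident_cells unfolding between_def by blast+
    have "\<phi> z \<in> between c x"
      using z x automorphism_link[OF \<phi> c cl(2)] automorphismD(5)[OF \<phi> cl(1,2)] unfolding between_def by simp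
    moreover have "card (between c x) = 2" using card_between x by blast
    then obtain p q where "between c x = {p, q}" unfolding card_2_iff by blast
    moreover have "\<phi> z = y \<longrightarrow> z = y" using inj_onD[OF inj _ cl(2,3)] y(2) by metis
    ultimately have "\<phi> z = z" using y z by auto
    moreover have "x \<in> between c z" "incident T c z" using x z incident_sym unfolding between_def by blast+
    ultimately show "z \<in> ?A" using x by blast
  qed blast
  then show ?thesis using z by blast
qed

text \<open>Automorphisms are rigid. Fixing the link of \<open>c\<close>, an automorphism fixes some face together
  with all its vertices and sides. Across each side, the diamond property makes it fix the
  adjacent face, the end of the side, and hence the whole link of the adjacent face. All faces are
  reached in this way, and every cell lies in the closure of a face.\<close>

lemma automorphism_fixing_link_trivial:
  assumes \<phi>: "\<phi> \<in> cell_automorphisms T" and c: "c \<in> cells T" "\<phi> c = c"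
    and link: "\<And>x. incident T c x \<Longrightarrow> \<phi> x = x" and x: "x \<in> cells T"
  shows "\<phi> x = x"
proof -
  let ?A = "{f \<in> faces T. \<phi> f = f \<and> (\<forall>x. incident T f x \<longrightarrow> \<phi> x = x)}"
  have btw: "between p q \<noteq> {}" if "incident T p q" for p q using card_between[OF that] by auto
  have flag: "f \<in> ?A" if f: "f \<in> faces T" "\<phi> f = f" "incident T f p" "\<phi> p = p" "q \<in> between f p" "\<phi> q = q" for f p q
    using link_fixed_by_flag[OF \<phi> _ f(2,3,5,4,6)] f(1,2) cellsI(3) by blast
  have "?A = faces T"
  proof (rule faces_strongly_connected)
    show "?A \<noteq> {}"
    proof (cases "c \<in> faces T")
      case False
      obtain f where f: "f \<in> faces T" "incident T c f"
      proof -
        obtain p where p: "incident T c p" using link_nonempty[OF c(1)] by blast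
        show thesis
        proof (cases "p \<in> faces T")
          case False
          obtain q where q: "q \<in> between c p" using btw[OF p] by blast
          have "c \<in> cells T" "p \<in> cells T" "q \<in> cells T" using p q incident_cells unfolding between_def by blast+
          have "q \<in> faces T"
          proof (rule ccontr)
            assume "q \<notin> faces T"
            have dim: "cell_dim T r < 2" if "r \<in> cells T" "r \<notin> faces T" for r
              using that(1) by (cases rule: cells_cases) (use that(2) dim_vertex dim_edge in auto)
            have "cell_dim T c \<noteq> cell_dim T p" "cell_dim T c \<noteq> cell_dim T q" "cell_dim T p \<noteq> cell_dim T q"
              using p q not_incident_same_dim unfolding between_def by blast+
            then show False using dim[of c] dim[of p] dim[of q] \<open>c \<in> cells T\<close> \<open>p \<in> cells T\<close> \<open>q \<in> cells T\<close>
              \<open>c \<notin> faces T\<close> \<open>p \<notin> faces T\<close> \<open>q \<notin> faces T\<close> by linarith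
          qed
          then show thesis using that q unfolding between_def by blast
        qed (use that p in blast)
      qed
      obtain q where q: "q \<in> between c f" using btw[OF f(2)] by blast
      then have "incident T f c" "q \<in> between f c" "\<phi> q = q" "\<phi> f = f"
        using f link incident_sym unfolding between_def by blast+
      then have "f \<in> ?A" using flag[OF f(1)] c(2) by blast
      then show ?thesis by blast
    qed (use c link in blast)
    fix e f g assume e: "e \<in> edges T" and f: "f \<in> ?A" and g: "g \<in> faces T" and ef: "e \<subseteq> closure f" "e \<subseteq> closure g"
    have fF: "f \<in> faces T" "\<phi> f = f" using f by blast+
    have i: "incident T e f" "incident T e g" using incident_edge_face[OF e] fF(1) g ef by simp_all
    then have i': "incident T f e" "incident T g e" using incident_sym[of T e] by simp_all
    have pe: "\<phi> e = e" using f i'(1) by blast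
    obtain a b where ab: "a \<noteq> b" "verts T \<inter> closure e = {a, b}" using edge_endpoints[OF e] .
    then have av: "a \<in> verts T" "a \<in> closure e" by auto
    have fa: "{a} \<in> between e f" "{a} \<in> between e g"
      using between_edge_face[OF e fF(1) ef(1)] between_edge_face[OF e g ef(2)] ab by simp_all
    then have pa: "\<phi> {a} = {a}" using f unfolding between_def by blast
    have pg: "\<phi> g = g"
      using link_fixed_by_flag[OF \<phi> cellsI(2)[OF e] pe i(1) fa(1) fF(2) pa i(2)] .
    show "g \<in> ?A" using flag[OF g pg i'(2) pe _ pa] fa(2) between_sym[of e g] by blast
  qed blast
  then have all: "\<phi> f = f \<and> (\<forall>x. incident T f x \<longrightarrow> \<phi> x = x)" if "f \<in> faces T" for f using that by blast
  show ?thesis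
    using x
  proof (cases rule: cells_cases)
    case (1 v)
    then have "v \<in> unit_sphere" using verts_sphere by blast
    then obtain f where "f \<in> faces T" "v \<in> closure f" using faces_cover by blast
    then show ?thesis using all[of f] incident_vertex_face[OF 1(1)] incident_sym 1(2) by blast
  next
    case 2
    then have "{f \<in> faces T. x \<subseteq> closure f} \<noteq> {}" using edge_two_faces[OF 2] by (metis card.empty zero_neq_numeral)
    then obtain f where "f \<in> faces T" "x \<subseteq> closure f" by blast
    then show ?thesis using all[of f] incident_edge_face[OF 2] incident_sym by blast
  next
    case 3
    then show ?thesis using all by blast
  qed
qed

end

section \<open>The dihedral representation\<close>

context triangulated_sphere
begin

lemma Aut_mult_closed:
  assumes "\<phi> \<in> carrier (Aut c T)" "\<psi> \<in> carrier (Aut c T)" and c: "c \<in> cells T"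
  shows "\<phi> \<otimes>\<^bsub>Aut c T\<^esub> \<psi> \<in> carrier (Aut c T)"
proof -
  have \<phi>: "\<phi> \<in> cell_automorphisms T" "\<phi> c = c" and \<psi>: "\<psi> \<in> cell_automorphisms T" "\<psi> c = c"
    using assms by (auto simp: carrier_Aut)
  have B: "\<phi> \<otimes>\<^bsub>Aut c T\<^esub> \<psi> \<in> Bij (cells T)"
    using automorphismD(1)[OF \<phi>(1)] automorphismD(1)[OF \<psi>(1)] by (simp add: Aut_def BijGroup_def compose_Bij)
  have cl: "\<psi> x \<in> cells T" if "x \<in> cells T" for x
    using automorphismD(3)[OF \<psi>(1)] that by (rule bij_betw_apply)
  have m: "(\<phi> \<otimes>\<^bsub>Aut c T\<^esub> \<psi>) x = \<phi> (\<psi> x)" if "x \<in> cells T" for x using mult_Aut[OF \<phi>(1) \<psi>(1) that] .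
  show ?thesis
    unfolding carrier_Aut cell_automorphisms_def
    using B m cl c \<phi> \<psi> by (simp add: automorphismD(4)[OF \<phi>(1)] automorphismD(4)[OF \<psi>(1)] automorphismD(5)[OF \<phi>(1)] automorphismD(5)[OF \<psi>(1)])
qed

lemma cell_dim_less_3: "x \<in> cells T \<Longrightarrow> cell_dim T x < 3"
  by (simp add: cell_dim_def)

text \<open>The link of \<open>c\<close> contains cells of two dimensions only, and neighbours in it have different
  dimensions. So the dimensions alternate around the link, which makes its length even.\<close>

lemma cyclic_order_dimensions:
  assumes c: "c \<in> cells T" and xs: "cyclic_order_at T c xs"
  shows "length xs = 2 * cell_degree T c"
    and "cell_dim T (cyclic_nth xs i) = cell_dim T (cyclic_nth xs j) \<longleftrightarrow> even (i - j)"
proof -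
  let ?a = "cyclic_nth xs" and ?n = "int (length xs)"
  note lc = cyclic_order_line_covering[OF c xs]
  have ne: "xs \<noteq> []" using lc(3) by auto
  have a: "incident T c (?a i)" for i using lc(5) by blast
  then have ac: "?a i \<in> cells T" for i using incident_cells by blast
  have dc: "cell_dim T (?a i) \<noteq> cell_dim T c" for i using not_incident_same_dim[of c "?a i"] a by metis
  have "link_adjacent c (?a i) (?a (i + 1))" for i using line_coveringD(2)[OF lc(4), of i] by blast
  then have d1: "cell_dim T (?a i) \<noteq> cell_dim T (?a (i + 1))" for i
    using not_incident_same_dim unfolding link_adjacent_def by blast
  have d2: "cell_dim T (?a (i + 2)) = cell_dim T (?a i)" for i
    using d1[of i] d1[of "i + 1"] dc[of i] dc[of "i + 1"] dc[of "i + 2"]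
      cell_dim_less_3[OF ac[of i]] cell_dim_less_3[OF ac[of "i + 1"]] cell_dim_less_3[OF ac[of "i + 2"]] cell_dim_less_3[OF c]
    by (simp add: algebra_simps)
  have d2k: "cell_dim T (?a (i + 2 * int k)) = cell_dim T (?a i)" for i k
    by (induction k) (use d2[of "i + 2 * int k" for k] in \<open>auto simp: algebra_simps\<close>)
  have ev: "cell_dim T (?a (i + 2 * k)) = cell_dim T (?a i)" for i k
    using d2k[of i "nat k"] d2k[of "i + 2 * k" "nat (- k)"] by (cases "k \<ge> 0") simp_all
  have dim: "cell_dim T (?a i) = cell_dim T (?a j) \<longleftrightarrow> even (i - j)" for i j
  proof (cases "even (i - j)")
    case True
    then obtain k where "i = j + 2 * k" by (metis add.commute diff_eq_eq dvdE)
    then show ?thesis using ev[of j k] True by simp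
  next
    case False
    then obtain k where "i = (j + 1) + 2 * k" by (metis add.commute add.left_commute diff_eq_eq oddE)
    then show ?thesis using ev[of "j + 1" k] d1[of j] False by simp
  qed
  then show "cell_dim T (?a i) = cell_dim T (?a j) \<longleftrightarrow> even (i - j)" .
  have "?a ?n = ?a 0" using cyclic_nth_eq_iff[OF lc(1) ne] by simp
  then have "even ?n" using dim[of ?n 0] by simp
  then obtain d where d: "length xs = 2 * d" by (metis evenE even_of_nat)
  \<comment> \<open>One of the two dimensions in the link is the one that counts for the degree.\<close>
  define q where "q = (cell_dim T c + 1) mod 3"
  have q: "q < 3" "q \<noteq> cell_dim T c" using cell_dim_less_3[OF c] unfolding q_def by presburger+
  have "cell_dim T (?a 0) = q \<or> cell_dim T (?a 1) = q"
    using q d1[of 0] dc[of 0] dc[of 1] cell_dim_less_3[OF ac[of 0]] cell_dim_less_3[OF ac[of 1]] cell_dim_less_3[OF c] by auto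
  then obtain i0 where i0: "i0 \<in> {0, 1}" "cell_dim T (?a i0) = q" by auto
  let ?b = "\<lambda>k. ?a (2 * k + i0)"
  have "bij_betw ?b {0..<int d} {x. incident T c x \<and> cell_dim T x = q}"
    unfolding bij_betw_def
  proof
    show "inj_on ?b {0..<int d}"
    proof (rule inj_onI)
      fix k l assume kl: "k \<in> {0..<int d}" "l \<in> {0..<int d}" and "?b k = ?b l"
      then have "2 * int d dvd (2 * k + i0) - (2 * l + i0)"
        unfolding cyclic_nth_eq_iff[OF lc(1) ne] mod_eq_dvd_iff d by simp
      then have "2 * int d dvd 2 * (k - l)" by (simp add: algebra_simps)
      then have "int d dvd k - l" unfolding dvd_mult_cancel_left by simp
      then have "k mod int d = l mod int d" by (simp add: mod_eq_dvd_iff)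
      then show "k = l" using kl by simp
    qed
    show "?b ` {0..<int d} = {x. incident T c x \<and> cell_dim T x = q}"
    proof (intro equalityI subsetI)
      fix x assume "x \<in> ?b ` {0..<int d}"
      then obtain k where "x = ?b k" by blast
      then show "x \<in> {x. incident T c x \<and> cell_dim T x = q}"
        using a dim[of "2 * k + i0" i0] i0(2) by simp
    next
      fix x assume x: "x \<in> {x. incident T c x \<and> cell_dim T x = q}"
      then have "x \<in> set xs" using lc(2) by blast
      then obtain i where i: "0 \<le> i" "i < ?n" "x = ?a i" using in_set_imp_cyclic_nth by metis
      then have "even (i - i0)" using dim[of i i0] x i0(2) by simp
      then obtain k where k: "i = 2 * k + i0" by (metis add.commute diff_eq_eq evenE add_diff_cancel_right' diff_add_cancel)
      then have "k \<in> {0..<int d}" using i(1,2) i0(1) d by auto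
      then show "x \<in> ?b ` {0..<int d}" using i(3) k by blast
    qed
  qed
  then have "cell_degree T c = d"
    unfolding cell_degree_def q_def[symmetric] using bij_betw_same_card by fastforce
  then show "length xs = 2 * cell_degree T c" using d by simp
qed

text \<open>Numbering the link cyclically, an automorphism acts on positions as \<open>i \<mapsto> b + i\<close> or \<open>i \<mapsto> b -
  i\<close>, with \<open>b\<close> even because dimensions are preserved. The representation sends it to \<open>b div 2\<close>
  together with the sign, and it is injective by rigidity.\<close>

lemma dihedral_representation:
  assumes c: "c \<in> cells T"
  obtains \<theta> where "cell_degree T c > 0" "\<theta> \<in> hom (Aut c T) (dihedral_group (cell_degree T c))"
    "inj_on \<theta> (carrier (Aut c T))" "\<one>\<^bsub>Aut c T\<^esub> \<in> carrier (Aut c T)" "\<theta> \<one>\<^bsub>Aut c T\<^esub> = (0, False)"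
    "\<And>\<phi>. \<phi> \<in> carrier (Aut c T) \<Longrightarrow> reflective_at T c \<phi> \<longleftrightarrow> snd (\<theta> \<phi>)"
proof -
  obtain xs where xs: "cyclic_order_at T c xs" using link_cyclic_order[OF c] .
  let ?G = "Aut c T"
  define d where "d = cell_degree T c"
  define a where "a = cyclic_nth xs"
  note lc = cyclic_order_line_covering[OF c xs, folded a_def]
  have len: "length xs = 2 * d" using cyclic_order_dimensions(1)[OF c xs] unfolding d_def .
  have ne: "xs \<noteq> []" and d2: "d \<ge> 2" using lc(3) len by auto
  have eq_iff: "a i = a j \<longleftrightarrow> i mod (2 * int d) = j mod (2 * int d)" for i j
    using cyclic_nth_eq_iff[OF lc(1) ne, of i j] unfolding a_def len by simp
  have ac: "a i \<in> cells T" for i using lc(5) incident_cells by blast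
  have autD: "\<phi> \<in> cell_automorphisms T" "\<phi> c = c" if "\<phi> \<in> carrier ?G" for \<phi> using that by (auto simp: carrier_Aut)
  define rel where "rel = (\<lambda>\<phi> p. p \<in> carrier (dihedral_group d) \<and> (\<forall>i. \<phi> (a i) = a (dihedral_action p i)))"
  have rel_uniq: "p = q" if "rel \<phi> p" "rel \<phi> q" for \<phi> p q
  proof (rule dihedral_action_faithful[OF _ _ d2])
    fix i
    have "a (dihedral_action p i) = a (dihedral_action q i)" using that unfolding rel_def by metis
    then show "dihedral_action p i mod (2 * int d) = dihedral_action q i mod (2 * int d)" unfolding eq_iff .
  qed (use that in \<open>auto simp: rel_def\<close>)
  have rel_ex: "\<exists>p. rel \<phi> p" if \<phi>: "\<phi> \<in> carrier ?G" for \<phi>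
  proof -
    have lc': "line_covering (link_adjacent c) (\<lambda>i. \<phi> (a i))"
      using automorphism_line_covering[OF autD(1)[OF \<phi>] c autD(2)[OF \<phi>] lc(4,5)] .
    have "\<phi> (a 0) \<in> range a"
      using automorphism_link[OF autD(1)[OF \<phi>] c autD(2)[OF \<phi>] ac] lc(5) by blast
    then obtain b s where b: "\<And>i. \<phi> (a i) = a (b + (if s then - i else i))"
    proof (rule line_coverings_agree[OF lc(4) lc'])
      fix b assume "\<And>i. \<phi> (a i) = a (b + i)"
      then show thesis using that[of b False] by simp
    next
      fix b assume "\<And>i. \<phi> (a i) = a (b - i)"
      then show thesis using that[of b True] by simp
    qed
    have "\<phi> (a 0) = a b" using b[of 0] by simp
    then have "cell_dim T (a b) = cell_dim T (a 0)" using automorphismD(4)[OF autD(1)[OF \<phi>] ac] by metis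
    then have "even b" using cyclic_order_dimensions(2)[OF c xs, of b 0] unfolding a_def by simp
    then obtain k where k: "b = 2 * k" by (elim evenE)
    have "a (b + (if s then - i else i)) = a (dihedral_action (k mod int d, s) i)" for i
      unfolding eq_iff dihedral_action_def k fst_conv snd_conv mult_mod_right by (rule mod_add_left_eq[symmetric])
    moreover have "(k mod int d, s) \<in> carrier (dihedral_group d)" using d2 by (simp add: carrier_dihedral_group)
    ultimately show ?thesis unfolding rel_def using b by metis
  qed
  define \<theta> where "\<theta> = (\<lambda>\<phi>. SOME p. rel \<phi> p)"
  have \<theta>: "rel \<phi> (\<theta> \<phi>)" if "\<phi> \<in> carrier ?G" for \<phi> unfolding \<theta>_def using rel_ex[OF that] by (rule someI_ex)
  have \<theta>_eq: "\<theta> \<phi> = p" if "\<phi> \<in> carrier ?G" "rel \<phi> p" for \<phi> p using rel_uniq[OF \<theta>[OF that(1)] that(2)] .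
  have \<theta>_act: "\<phi> (a i) = a (dihedral_action (\<theta> \<phi>) i)" if "\<phi> \<in> carrier ?G" for \<phi> i using \<theta>[OF that] unfolding rel_def by blast
  have \<theta>_car: "\<theta> \<phi> \<in> carrier (dihedral_group d)" if "\<phi> \<in> carrier ?G" for \<phi> using \<theta>[OF that] unfolding rel_def by blast
  have grp: "group (dihedral_group d)" using group_dihedral_group d2 by simp
  have hom: "\<theta> \<in> hom ?G (dihedral_group d)"
  proof (rule homI)
    fix \<phi> \<psi> assume \<phi>: "\<phi> \<in> carrier ?G" and \<psi>: "\<psi> \<in> carrier ?G"
    have "(\<phi> \<otimes>\<^bsub>?G\<^esub> \<psi>) (a i) = a (dihedral_action (\<theta> \<phi> \<otimes>\<^bsub>dihedral_group d\<^esub> \<theta> \<psi>) i)" for i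
    proof -
      have "(\<phi> \<otimes>\<^bsub>?G\<^esub> \<psi>) (a i) = \<phi> (\<psi> (a i))" using mult_Aut[OF autD(1)[OF \<phi>] autD(1)[OF \<psi>] ac] .
      also have "\<dots> = a (dihedral_action (\<theta> \<phi>) (dihedral_action (\<theta> \<psi>) i))"
        unfolding \<theta>_act[OF \<psi>] by (rule \<theta>_act[OF \<phi>])
      also have "\<dots> = a (dihedral_action (\<theta> \<phi> \<otimes>\<^bsub>dihedral_group d\<^esub> \<theta> \<psi>) i)"
        unfolding eq_iff by (rule dihedral_action_mult[symmetric])
      finally show ?thesis .
    qed
    moreover have "\<theta> \<phi> \<otimes>\<^bsub>dihedral_group d\<^esub> \<theta> \<psi> \<in> carrier (dihedral_group d)"
      using group.is_monoid[OF grp] monoid.m_closed \<theta>_car \<phi> \<psi> by metis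
    ultimately show "\<theta> (\<phi> \<otimes>\<^bsub>?G\<^esub> \<psi>) = \<theta> \<phi> \<otimes>\<^bsub>dihedral_group d\<^esub> \<theta> \<psi>"
      using \<theta>_eq[OF Aut_mult_closed[OF \<phi> \<psi> c]] unfolding rel_def by blast
  qed (rule \<theta>_car)
  have inj: "inj_on \<theta> (carrier ?G)"
  proof (rule inj_onI)
    fix \<phi> \<psi> assume \<phi>: "\<phi> \<in> carrier ?G" and \<psi>: "\<psi> \<in> carrier ?G" and eq: "\<theta> \<phi> = \<theta> \<psi>"
    have same: "\<phi> (a i) = \<psi> (a i)" for i using \<theta>_act[OF \<phi>] \<theta>_act[OF \<psi>] eq by simp
    \<comment> \<open>The quotient \<open>\<psi>\<^sup>-\<^sup>1 \<phi>\<close> fixes the link pointwise.\<close>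
    define \<rho> where "\<rho> = (\<lambda>x\<in>cells T. inv_into (cells T) \<psi> (\<phi> x))"
    have inv: "inv_into (cells T) \<psi> (\<psi> x) = x" if "x \<in> cells T" for x
      using automorphismD(3)[OF autD(1)[OF \<psi>]] that by (simp add: bij_betw_def)
    have inv': "\<psi> (inv_into (cells T) \<psi> x) = x" "inv_into (cells T) \<psi> x \<in> cells T" if "x \<in> cells T" for x
      using automorphismD(3)[OF autD(1)[OF \<psi>]] that by (auto simp: bij_betw_def f_inv_into_f inv_into_into)
    have \<phi>c: "\<phi> x \<in> cells T" if "x \<in> cells T" for x using automorphismD(3)[OF autD(1)[OF \<phi>]] that by (rule bij_betw_apply)
    have \<rho>: "\<rho> x \<in> cells T" "\<psi> (\<rho> x) = \<phi> x" if "x \<in> cells T" for x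
      using inv'[OF \<phi>c[OF that]] that unfolding \<rho>_def by simp_all
    have "bij_betw (inv_into (cells T) \<psi> \<circ> \<phi>) (cells T) (cells T)"
      using automorphismD(3)[OF autD(1)[OF \<phi>]] bij_betw_inv_into[OF automorphismD(3)[OF autD(1)[OF \<psi>]]] by (rule bij_betw_trans)
    then have "\<rho> \<in> Bij (cells T)" unfolding Bij_def \<rho>_def by (simp add: comp_def)
    moreover have "cell_dim T (\<rho> x) = cell_dim T x" if "x \<in> cells T" for x
      using automorphismD(4)[OF autD(1)[OF \<psi>] \<rho>(1)[OF that]] automorphismD(4)[OF autD(1)[OF \<phi>] that] \<rho>(2)[OF that] by simp
    moreover have "incident T (\<rho> x) (\<rho> y) \<longleftrightarrow> incident T x y" if "x \<in> cells T" "y \<in> cells T" for x y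
      using automorphismD(5)[OF autD(1)[OF \<psi>] \<rho>(1) \<rho>(1)] automorphismD(5)[OF autD(1)[OF \<phi>]] \<rho>(2) that by simp
    ultimately have \<rho>A: "\<rho> \<in> cell_automorphisms T" unfolding cell_automorphisms_def by simp
    have "\<rho> c = c" using inv[OF c] autD(2)[OF \<phi>] autD(2)[OF \<psi>] c unfolding \<rho>_def by simp
    moreover have "\<rho> x = x" if "incident T c x" for x
    proof -
      obtain i where i: "x = a i" using lc(5) \<open>incident T c x\<close> by blast
      show ?thesis unfolding \<rho>_def i using inv[OF ac] same ac by simp
    qed
    ultimately have "\<rho> x = x" if "x \<in> cells T" for x
      using automorphism_fixing_link_trivial[OF \<rho>A c _ _ that] by blast
    then have "\<phi> x = \<psi> x" if "x \<in> cells T" for x using \<rho>(2)[OF that] that by simp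
    then show "\<phi> = \<psi>"
      using automorphismD(2)[OF autD(1)[OF \<phi>]] automorphismD(2)[OF autD(1)[OF \<psi>]] by (rule extensionalityI[rotated 2])
  qed
  have one: "\<one>\<^bsub>?G\<^esub> \<in> carrier ?G"
    unfolding carrier_Aut one_Aut cell_automorphisms_def using c id_Bij by simp
  have \<theta>1: "\<theta> \<one>\<^bsub>?G\<^esub> = (0, False)"
    using d2 ac by (intro \<theta>_eq[OF one]) (auto simp: rel_def carrier_dihedral_group dihedral_action_def one_Aut)
  have refl: "reflective_at T c \<phi> \<longleftrightarrow> snd (\<theta> \<phi>)" if \<phi>: "\<phi> \<in> carrier ?G" for \<phi>
  proof
    assume s: "snd (\<theta> \<phi>)"
    have "\<phi> \<noteq> \<one>\<^bsub>?G\<^esub>" using s \<theta>1 by auto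
    moreover have "map \<phi> xs = rotate (nat ((- 1 - 2 * fst (\<theta> \<phi>)) mod (2 * int d))) (rev xs)"
      unfolding map_eq_rotate_rev_iff[OF ne]
    proof
      fix i
      let ?k = "(- 1 - 2 * fst (\<theta> \<phi>)) mod (2 * int d)"
      have k: "int (nat ?k) = ?k" using d2 by simp
      have "\<phi> (a i) = a (2 * fst (\<theta> \<phi>) - i)" using \<theta>_act[OF \<phi>, of i] s by (simp add: dihedral_action_def)
      also have "(- 1 - ?k - i) mod (2 * int d) = (- 1 - (- 1 - 2 * fst (\<theta> \<phi>)) - i) mod (2 * int d)"
        by (metis mod_diff_left_eq mod_diff_right_eq)
      then have "a (2 * fst (\<theta> \<phi>) - i) = a (- 1 - int (nat ?k) - i)"
        unfolding k eq_iff by simp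
      finally show "\<phi> (cyclic_nth xs i) = cyclic_nth xs (- 1 - int (nat ?k) - i)" unfolding a_def .
    qed
    ultimately show "reflective_at T c \<phi>" unfolding reflective_at_def using \<phi> xs by blast
  next
    assume "reflective_at T c \<phi>"
    then obtain ys k where ys: "cyclic_order_at T c ys" "map \<phi> ys = rotate k (rev ys)" unfolding reflective_at_def by blast
    note lcy = cyclic_order_line_covering[OF c ys(1)]
    have "ys \<noteq> []" using lcy(3) by auto
    then have rot: "\<phi> (cyclic_nth ys i) = cyclic_nth ys (- 1 - int k - i)" for i
      using ys(2) map_eq_rotate_rev_iff by blast
    have "cyclic_nth ys 0 \<in> range a" using lcy(5) lc(5) by blast
    then obtain b s where b: "\<And>i. cyclic_nth ys i = a (b + (if s then - i else i))"
    proof (rule line_coverings_agree[OF lc(4) lcy(4)])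
      fix b assume "\<And>i. cyclic_nth ys i = a (b + i)"
      then show thesis using that[of b False] by simp
    next
      fix b assume "\<And>i. cyclic_nth ys i = a (b - i)"
      then show thesis using that[of b True] by simp
    qed
    \<comment> \<open>The witness may use another cyclic order, which differs from \<open>xs\<close> by a symmetry of the line. Reversing it cannot be a rotation of \<open>xs\<close>: comparing positions 0 and 1, the length \<open>2 d\<close>, which is at least 4, would divide 2.\<close>
    show "snd (\<theta> \<phi>)"
    proof (rule ccontr)
      assume ns: "\<not> snd (\<theta> \<phi>)"
      define e :: int where "e = (if s then -1 else 1)"
      have e: "(if s then - i else i) = e * i" for i unfolding e_def by simp
      have "a (2 * fst (\<theta> \<phi>) + (b + e * i)) = a (b + e * (- 1 - int k - i))" for i
        using rot[of i] \<theta>_act[OF \<phi>, of "b + e * i"] ns unfolding b e by (simp add: dihedral_action_def)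
      then have dvd: "2 * int d dvd (2 * fst (\<theta> \<phi>) + (b + e * i)) - (b + e * (- 1 - int k - i))" for i
        unfolding eq_iff mod_eq_dvd_iff .
      have "2 * int d dvd ((2 * fst (\<theta> \<phi>) + (b + e * 1)) - (b + e * (- 1 - int k - 1))) - ((2 * fst (\<theta> \<phi>) + (b + e * 0)) - (b + e * (- 1 - int k - 0)))"
        by (rule dvd_diff[OF dvd dvd])
      then have "2 * int d dvd 2 * e" by (simp add: algebra_simps)
      then have "2 * int d dvd 2" unfolding e_def by (simp split: if_splits)
      then show False using d2 zdvd_imp_le[of "2 * int d" 2] by simp
    qed
  qed
  show ?thesis using that[of \<theta>, folded d_def] d2 hom inj one \<theta>1 refl by simp
qed

end

theorem theorem3p6:
  fixes T :: embedded_graph and c0 :: "(real^3) set"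
    and H :: "((real^3) set \<Rightarrow> (real^3) set) set"
  assumes "sphere_triangulation T"
    and "c0 \<in> cells T"
    and "subgroup H (Aut c0 T)"
    and "\<exists>\<phi>\<in>H. \<phi> \<noteq> \<one>\<^bsub>Aut c0 T\<^esub>"
  shows "((\<exists>\<phi>\<in>H. reflective_at T c0 \<phi>) \<and> \<not> (\<exists>\<phi>\<in>H. rotative_at T c0 \<phi>) \<longrightarrow>
            (Aut c0 T)\<lparr>carrier := H\<rparr> \<cong> integer_mod_group 2)
       \<and> (\<forall>k\<ge>1. card {\<phi>\<in>H. rotative_at T c0 \<phi>} = k \<and>
                 \<not> (\<exists>\<phi>\<in>H. reflective_at T c0 \<phi>) \<longrightarrow>
            (Aut c0 T)\<lparr>carrier := H\<rparr> \<cong> integer_mod_group (k + 1) \<and>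
            (k + 1) dvd cell_degree T c0)
       \<and> ((\<exists>\<phi>\<in>H. reflective_at T c0 \<phi>) \<and> (\<exists>\<phi>\<in>H. rotative_at T c0 \<phi>) \<longrightarrow>
            (\<exists>n\<ge>2. n dvd cell_degree T c0 \<and>
                   (Aut c0 T)\<lparr>carrier := H\<rparr> \<cong> dihedral_group n))"
proof -
  interpret triangulated_sphere T using assms(1) by unfold_locales
  let ?G = "Aut c0 T" and ?d = "cell_degree T c0"
  let ?R = "{\<phi>\<in>H. rotative_at T c0 \<phi>}"
  obtain \<theta> where \<theta>: "?d > 0" "\<theta> \<in> hom ?G (dihedral_group ?d)" "inj_on \<theta> (carrier ?G)"
    "\<one>\<^bsub>?G\<^esub> \<in> carrier ?G" "\<theta> \<one>\<^bsub>?G\<^esub> = (0, False)"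
    "\<And>\<phi>. \<phi> \<in> carrier ?G \<Longrightarrow> reflective_at T c0 \<phi> \<longleftrightarrow> snd (\<theta> \<phi>)"
    using dihedral_representation[OF assms(2)] by blast
  have HG: "H \<subseteq> carrier ?G" and H1: "\<one>\<^bsub>?G\<^esub> \<in> H" and Hm: "\<And>x y. x \<in> H \<Longrightarrow> y \<in> H \<Longrightarrow> x \<otimes>\<^bsub>?G\<^esub> y \<in> H"
    using assms(3) by (auto simp: subgroup_def)
  have hom: "\<theta> (x \<otimes>\<^bsub>?G\<^esub> y) = \<theta> x \<otimes>\<^bsub>dihedral_group ?d\<^esub> \<theta> y" if "x \<in> H" "y \<in> H" for x y
    using hom_mult[OF \<theta>(2)] HG that by blast
  let ?K = "\<theta> ` H"
  have K: "?K \<subseteq> carrier (dihedral_group ?d)" using hom_in_carrier[OF \<theta>(2)] HG by blast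
  have K1: "(0, False) \<in> ?K" using H1 \<theta>(5) by (metis imageI)
  have Km: "x \<otimes>\<^bsub>dihedral_group ?d\<^esub> y \<in> ?K" if "x \<in> ?K" "y \<in> ?K" for x y
  proof -
    obtain \<phi> \<psi> where "\<phi> \<in> H" "x = \<theta> \<phi>" "\<psi> \<in> H" "y = \<theta> \<psi>" using \<open>x \<in> ?K\<close> \<open>y \<in> ?K\<close> by blast
    then show ?thesis using hom[of \<phi> \<psi>] Hm[of \<phi> \<psi>] by (metis imageI)
  qed
  obtain n where n: "n > 0" "n dvd ?d" "card {x \<in> ?K. \<not> snd x} = n"
    "(\<forall>x\<in>?K. \<not> snd x) \<longrightarrow> (dihedral_group ?d)\<lparr>carrier := ?K\<rparr> \<cong> integer_mod_group n"
    "(\<exists>x\<in>?K. snd x) \<longrightarrow> (dihedral_group ?d)\<lparr>carrier := ?K\<rparr> \<cong> dihedral_group n"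
    using dihedral_group_submonoid[OF \<theta>(1) K K1 Km] .
  have injH: "inj_on \<theta> H" using \<theta>(3) HG by (rule inj_on_subset)
  have "\<theta> \<in> iso (?G\<lparr>carrier := H\<rparr>) ((dihedral_group ?d)\<lparr>carrier := ?K\<rparr>)"
    unfolding iso_def hom_def using hom injH by (auto simp: bij_betw_def)
  then have iso: "?G\<lparr>carrier := H\<rparr> \<cong> (dihedral_group ?d)\<lparr>carrier := ?K\<rparr>" by (rule is_isoI)
  have refl: "reflective_at T c0 \<phi> \<longleftrightarrow> snd (\<theta> \<phi>)" if "\<phi> \<in> H" for \<phi> using \<theta>(6) that HG by blast
  have rota: "rotative_at T c0 \<phi> \<longleftrightarrow> \<phi> \<noteq> \<one>\<^bsub>?G\<^esub> \<and> \<not> snd (\<theta> \<phi>)" if "\<phi> \<in> H" for \<phi>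
    using refl[OF that] that HG unfolding rotative_at_def by blast
  have "{x \<in> ?K. \<not> snd x} = \<theta> ` {\<phi> \<in> H. \<not> snd (\<theta> \<phi>)}" by blast
  then have cn: "card {\<phi> \<in> H. \<not> snd (\<theta> \<phi>)} = n"
    using n(3) card_image[OF inj_on_subset[OF injH, of "{\<phi> \<in> H. \<not> snd (\<theta> \<phi>)}"]] by auto
  \<comment> \<open>The identity is the only element of \<open>H\<close> that is neither reflective nor rotative.\<close>
  have ins: "{\<phi> \<in> H. \<not> snd (\<theta> \<phi>)} = insert \<one>\<^bsub>?G\<^esub> ?R" using rota H1 \<theta>(5) by auto
  have "finite {\<phi> \<in> H. \<not> snd (\<theta> \<phi>)}" by (rule card_ge_0_finite) (simp only: cn n(1))
  then have finR: "finite ?R" unfolding ins by simp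
  have "\<one>\<^bsub>?G\<^esub> \<notin> ?R" using rota by blast
  then have card: "n = card ?R + 1" using cn card_insert_disjoint[OF finR] unfolding ins by simp
  have cyc: "?G\<lparr>carrier := H\<rparr> \<cong> integer_mod_group n" if "\<not> (\<exists>\<phi>\<in>H. reflective_at T c0 \<phi>)"
  proof -
    have "\<forall>x\<in>?K. \<not> snd x" using refl that by blast
    then show ?thesis using iso_trans[OF iso] n(4) by blast
  qed
  have dih: "?G\<lparr>carrier := H\<rparr> \<cong> dihedral_group n" if "\<exists>\<phi>\<in>H. reflective_at T c0 \<phi>"
  proof -
    have "\<exists>x\<in>?K. snd x" using refl that by blast
    then show ?thesis using iso_trans[OF iso] n(5) by blast
  qed
  show ?thesis
  proof (intro conjI impI allI)
    assume h: "(\<exists>\<phi>\<in>H. reflective_at T c0 \<phi>) \<and> \<not> (\<exists>\<phi>\<in>H. rotative_at T c0 \<phi>)"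
    then have "?R = {}" by blast
    then have "n = 1" using card by (simp only: card.empty)
    then show "?G\<lparr>carrier := H\<rparr> \<cong> integer_mod_group 2"
      using iso_trans[OF _ dihedral_group_1_iso] dih h by simp
  next
    fix k assume "card ?R = k \<and> \<not> (\<exists>\<phi>\<in>H. reflective_at T c0 \<phi>)"
    then show "?G\<lparr>carrier := H\<rparr> \<cong> integer_mod_group (k + 1)" "k + 1 dvd ?d"
      using cyc card n(2) by auto
  next
    assume h: "(\<exists>\<phi>\<in>H. reflective_at T c0 \<phi>) \<and> (\<exists>\<phi>\<in>H. rotative_at T c0 \<phi>)"
    then have "card ?R > 0" using finR by (auto simp: card_gt_0_iff)
    then have "n \<ge> 2" using card by simp
    then show "\<exists>n\<ge>2. n dvd ?d \<and> ?G\<lparr>carrier := H\<rparr> \<cong> dihedral_group n" using n(2) dih h by blast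
  qed
qed

end
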